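(* There is an algorithm that, given a set $\mathcal T$ of $m$ state sequences, each of length at most $n$, and a set $\mathcal C$ of $k$ criteria (with no further restrictions on the criteria), computes a valid flow diagram for $\mathcal T$ with the minimum possible number of nodes in $O((n+1)^{2m}\,k\cdot T(m,n))$ time, where $T(m,n)$ is the time required to check whether a set of at most $m$ subsequences, each of length at most $n$, fulfils a criterion.
   Context: A state sequence is a finite sequence of states. A criterion is a Boolean predicate evaluated on a set of contiguous subsequences (segments) taken from the input state sequences; a set of segments fulfils $C$ if $C$ evaluates to true on it. A segmentation of a state sequence $\tau$ is a partition of $\tau$ into consecutive nonempty contiguous subsequences, called segments. A flow diagram is a node-labelled directed acyclic graph with a source node $s$ and a sink node $t$, in which every other node is labelled by a criterion from $\mathcal C$; its size is its number of nodes. A flow diagram $F$ is valid for $\mathcal T=\{\tau_1,\dots,\tau_m\}$ if for each $\tau_i$ there is a segmentation $(\sigma_{i,1},\dots,\sigma_{i,r_i})$ of $\tau_i$ and an $s$–$t$ path $s,v_{i,1},\dots,v_{i,r_i},t$ in $F$ such that for every node $v\neq s,t$ of $F$, the set of all segments $\sigma_{i,j}$ with $v_{i,j}=v$ jointly fulfils the criterion labelling $v$. *)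

theory Defs
  imports Main
begin

text \<open>A segment is the index of the sequence it is taken from, its start position, and its states.
  Keeping index and position lets a criterion tell apart equal stretches of states taken
  from different places; criteria that look at the states only are a special case.\<close>

type_synonym 'a segment = "nat \<times> nat \<times> 'a list"
type_synonym 'a criterion = "'a segment set \<Rightarrow> bool"

definition segments :: "'a list list \<Rightarrow> 'a segment set" where
  "segments ts = {(i, a, xs). i < length ts \<and> xs \<noteq> [] \<and>
     (\<exists>ys zs. ts ! i = ys @ xs @ zs \<and> length ys = a)}"

definition segmentation :: "'a list \<Rightarrow> 'a list list \<Rightarrow> bool" where
  "segmentation \<tau> \<sigma> \<longleftrightarrow> concat \<sigma> = \<tau> \<and> [] \<notin> set \<sigma>"

definition nth_segment :: "nat \<Rightarrow> 'a list list \<Rightarrow> nat \<Rightarrow> 'a segment" where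
  "nth_segment i \<sigma> j = (i, length (concat (take j \<sigma>)), \<sigma> ! j)"

record 'a flow_diagram =
  nodes :: "nat set"
  edges :: "(nat \<times> nat) set"
  src :: nat
  snk :: nat
  label :: "nat \<Rightarrow> 'a criterion"  \<comment> \<open>irrelevant at source and sink\<close>

definition flow_diagram :: "'a criterion set \<Rightarrow> 'a flow_diagram \<Rightarrow> bool" where
  "flow_diagram \<C> F \<longleftrightarrow>
     finite (nodes F) \<and> edges F \<subseteq> nodes F \<times> nodes F \<and> acyclic (edges F) \<and>
     src F \<in> nodes F \<and> snk F \<in> nodes F \<and> src F \<noteq> snk F \<and>
     src F \<notin> Range (edges F) \<and> snk F \<notin> Domain (edges F) \<and>
     (\<forall>v \<in> nodes F - {src F, snk F}. label F v \<in> \<C>)"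

definition fd_size :: "'a flow_diagram \<Rightarrow> nat" where
  "fd_size F = card (nodes F)"

definition is_path :: "'a flow_diagram \<Rightarrow> nat list \<Rightarrow> bool" where
  "is_path F p \<longleftrightarrow> successively (\<lambda>u v. (u, v) \<in> edges F) p"

definition valid_for :: "'a list list \<Rightarrow> 'a flow_diagram \<Rightarrow> bool" where
  "valid_for ts F \<longleftrightarrow> (\<exists>\<sigma> p.
     (\<forall>i < length ts. segmentation (ts ! i) (\<sigma> i) \<and> length (p i) = length (\<sigma> i) \<and>
        is_path F (src F # p i @ [snk F])) \<and>
     (\<forall>v \<in> nodes F - {src F, snk F}.
        label F v {nth_segment i (\<sigma> i) j | i j. i < length ts \<and> j < length (\<sigma> i) \<and> p i ! j = v}))"

definition minimum_valid :: "'a list list \<Rightarrow> 'a criterion set \<Rightarrow> 'a flow_diagram \<Rightarrow> bool" where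
  "minimum_valid ts \<C> F \<longleftrightarrow> flow_diagram \<C> F \<and> valid_for ts F \<and>
     (\<forall>F'. flow_diagram \<C> F' \<and> valid_for ts F' \<longrightarrow> fd_size F \<le> fd_size F')"

text \<open>A deterministic uniform-cost random access machine, as a while language over finitely many
  named arrays of natural numbers (a scalar is cell 0 of its array). Arithmetic is restricted to
  addition and truncated subtraction: unit-cost multiplication of unbounded numbers would be
  unrealistically powerful. Every operation costs at least one step.\<close>

type_synonym vname = string
type_synonym state = "vname \<Rightarrow> nat \<Rightarrow> nat"

datatype exp = Const nat | Cell vname exp | Add exp exp | Sub exp exp

fun aval :: "exp \<Rightarrow> state \<Rightarrow> nat" where
  "aval (Const v) s = v"
| "aval (Cell x e) s = s x (aval e s)"
| "aval (Add e f) s = aval e s + aval f s"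
| "aval (Sub e f) s = aval e s - aval f s"

fun cost :: "exp \<Rightarrow> nat" where
  "cost (Const v) = 1"
| "cost (Cell x e) = 1 + cost e"
| "cost (Add e f) = 1 + cost e + cost f"
| "cost (Sub e f) = 1 + cost e + cost f"

text \<open>The tests of \<open>Cond\<close> and \<open>While\<close> compare two expressions by \<open><\<close>.\<close>

datatype com =
    Skip
  | Assign vname exp exp
  | Seq com com
  | Cond exp exp com com
  | While exp exp com
  | Check vname exp vname vname

definition update :: "state \<Rightarrow> vname \<Rightarrow> nat \<Rightarrow> nat \<Rightarrow> state" where
  "update s x i v = s(x := (s x)(i := v))"

text \<open>The segments with end points given by \<open>lo\<close> and \<open>hi\<close> (\<open>hi\<close> exclusive);
  sequence \<open>i\<close> contributes no segment if \<open>lo i = hi i\<close>.\<close>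

definition selected :: "'a list list \<Rightarrow> (nat \<Rightarrow> nat) \<Rightarrow> (nat \<Rightarrow> nat) \<Rightarrow> 'a segment set" where
  "selected ts lo hi =
     {(i, lo i, take (hi i - lo i) (drop (lo i) (ts ! i))) | i. i < length ts \<and> lo i < hi i}"

text \<open>\<open>exec ts Cs ck c s t s'\<close>: started in \<open>s\<close>, command \<open>c\<close> halts after \<open>t\<close> steps in \<open>s'\<close>.
  States and criteria are opaque: a program sees them only through \<open>Check x e lo hi\<close>, which tests
  the criterion with index \<open>e\<close> on the segments delimited by the arrays \<open>lo\<close> and \<open>hi\<close> and stores
  the answer in \<open>x\<close>. Its time is that of the test itself, given by \<open>ck\<close>, besides the usual
  overhead. An ill-formed \<open>Check\<close> has no execution.\<close>

inductive exec :: "'a list list \<Rightarrow> 'a criterion list \<Rightarrow> (nat \<Rightarrow> 'a segment set \<Rightarrow> nat) \<Rightarrow>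
    com \<Rightarrow> state \<Rightarrow> nat \<Rightarrow> state \<Rightarrow> bool"
  for ts :: "'a list list" and Cs :: "'a criterion list" and ck :: "nat \<Rightarrow> 'a segment set \<Rightarrow> nat"
where
  Skip: "exec ts Cs ck Skip s 1 s"
| Assign: "exec ts Cs ck (Assign x e f) s (1 + cost e + cost f) (update s x (aval e s) (aval f s))"
| Seq: "exec ts Cs ck c s t s' \<Longrightarrow> exec ts Cs ck d s' t' s'' \<Longrightarrow>
    exec ts Cs ck (Seq c d) s (t + t') s''"
| CondTrue: "aval e s < aval f s \<Longrightarrow> exec ts Cs ck c s t s' \<Longrightarrow>
    exec ts Cs ck (Cond e f c d) s (1 + cost e + cost f + t) s'"
| CondFalse: "\<not> aval e s < aval f s \<Longrightarrow> exec ts Cs ck d s t s' \<Longrightarrow>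
    exec ts Cs ck (Cond e f c d) s (1 + cost e + cost f + t) s'"
| WhileFalse: "\<not> aval e s < aval f s \<Longrightarrow>
    exec ts Cs ck (While e f c) s (1 + cost e + cost f) s"
| WhileTrue: "aval e s < aval f s \<Longrightarrow> exec ts Cs ck c s t s' \<Longrightarrow>
    exec ts Cs ck (While e f c) s' t' s'' \<Longrightarrow>
    exec ts Cs ck (While e f c) s (1 + cost e + cost f + t + t') s''"
| Check: "aval e s < length Cs \<Longrightarrow>
    \<forall>i < length ts. s lo i \<le> s hi i \<and> s hi i \<le> length (ts ! i) \<Longrightarrow>
    S = selected ts (s lo) (s hi) \<Longrightarrow>
    exec ts Cs ck (Check x e lo hi) s (1 + cost e + ck (aval e s) S)
      (update s x 0 (if (Cs ! aval e s) S then 1 else 0))"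

lemma exec_deterministic:
  "exec ts Cs ck c s t s' \<Longrightarrow> exec ts Cs ck c s u s'' \<Longrightarrow> t = u \<and> s' = s''"
proof (induction arbitrary: u s'' rule: exec.induct)
  case (Seq c s t s' d t' s1)
  from Seq.prems show ?case by cases (use Seq.IH in blast)
next
  case (WhileTrue e s f c t s' t' s1)
  from WhileTrue.prems show ?case by cases (use WhileTrue.IH WhileTrue.hyps in blast)+
qed (erule exec.cases; fastforce)+

definition initial :: "'a list list \<Rightarrow> nat \<Rightarrow> nat \<Rightarrow> state" where
  "initial ts n k = (\<lambda>x j.
     if x = ''m'' \<and> j = 0 then length ts
     else if x = ''n'' \<and> j = 0 then n
     else if x = ''k'' \<and> j = 0 then k
     else if x = ''len'' \<and> j < length ts then length (ts ! j)
     else 0)"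

text \<open>A result of 0 nodes means that there is no valid flow diagram.\<close>

definition result :: "'a criterion list \<Rightarrow> state \<Rightarrow> 'a flow_diagram option" where
  "result Cs s =
     (if s ''nodes'' 0 = 0 then None
      else Some \<lparr>nodes = {..<s ''nodes'' 0},
                 edges = {(s ''tail'' j, s ''head'' j) | j. j < s ''edges'' 0},
                 src = s ''src'' 0,
                 snk = s ''snk'' 0,
                 label = (\<lambda>v. Cs ! s ''label'' v)\<rparr>)"

definition check_time_bound ::
    "'a list list \<Rightarrow> nat \<Rightarrow> (nat \<Rightarrow> 'a segment set \<Rightarrow> nat) \<Rightarrow> nat \<Rightarrow> nat \<Rightarrow> nat \<Rightarrow> bool" where
  "check_time_bound ts k ck m n b \<longleftrightarrow>
     (\<forall>c < k. \<forall>S \<subseteq> segments ts. card S \<le> m \<and> (\<forall>(i, a, xs) \<in> S. length xs \<le> n) \<longrightarrow> ck c S \<le> b)"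

end

theory Submission
  imports Defs
begin

text \<open>The path of a sequence visits a node at most once, so going through the nodes of a valid flow
  diagram in topological order cuts every sequence node by node. A valid flow diagram thus becomes a
  path from the origin to the vector of lengths in the grid of prefix lengths, whose steps go from
  \<open>a\<close> to \<open>b \<ge> a\<close> and are allowed if some criterion holds for the segments between \<open>a\<close> and \<open>b\<close>.
  Conversely, a path becomes a chain of nodes with all forward edges. Hence a minimum flow diagram is
  a shortest path, found by relaxing all pairs \<open>a \<le> b\<close> once, in an order in which all pairs \<open>(a, b)\<close>
  precede the pairs \<open>(b, c)\<close>.

  Moving from one pair to the next costs \<open>O(m)\<close>, a factor the time bound does not contain. It
  is paid for by the number of pairs: for \<open>n \<ge> 1\<close> each coordinate has at most
  \<open>(n + 1) (n + 2) / 2 \<le> 3/4 (n + 1)^2\<close> pairs, so there are at most \<open>(3/4)^m (n + 1)^(2 m)\<close>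
  of them, and \<open>m (3/4)^m\<close> is bounded.\<close>

section \<open>A timed weakest precondition calculus\<close>

text \<open>One pass over the pairs suffices because of the digit \<open>tri (b i) + a i\<close>
  given to a pair: if \<open>a \<le> b \<le> c\<close>, then
  \<open>tri b + a \<le> tri c + b\<close> in each coordinate. So the value of a vertex no longer
  changes once a pair leaving it has been relaxed. The same digits turn the move to the next pair
  into adding 1 to a counter, and the array indices of both ends follow by adding stored powers of
  \<open>n + 1\<close>, as the machine cannot multiply. A step may leave every sequence where it is.
  It stands for a node that no path visits, whose criterion must hold for the empty set. Such nodes
  still count in the size, so the lower bound for arbitrary valid diagrams has to tell moving steps
  from stationary ones. All forward edges are drawn since different sequences skip different nodes.
  Writing them is quadratic in the number of nodes, which is affordable because a shortest path has
  fewer than \<open>(n + 1) ^ m\<close> steps.\<close>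

fun writes :: "com \<Rightarrow> vname set" where
  "writes Skip = {}"
| "writes (Assign x e f) = {x}"
| "writes (Seq c d) = writes c \<union> writes d"
| "writes (Cond e f c d) = writes c \<union> writes d"
| "writes (While e f c) = writes c"
| "writes (Check x e lo hi) = {x}"

text \<open>The frame condition of a command. The loop rules supply it relative to the start of the
  loop, so invariants mention only what changes.\<close>

definition unchanged :: "vname set \<Rightarrow> state \<Rightarrow> state \<Rightarrow> bool" where
  "unchanged X s s' \<longleftrightarrow> (\<forall>y. y \<notin> X \<longrightarrow> s' y = s y)"

lemma unchanged_refl: "unchanged X s s"
  by (simp add: unchanged_def)

lemma unchanged_trans: "unchanged X s s' \<Longrightarrow> unchanged Y s' s'' \<Longrightarrow> unchanged (X \<union> Y) s s''"
  by (simp add: unchanged_def)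

lemma exec_unchanged: "exec ts Cs ck c s t s' \<Longrightarrow> unchanged (writes c) s s'"
  by (induction rule: exec.induct) (auto simp: unchanged_def update_def)

text \<open>Commands without loops and checks are run symbolically: the simplifier computes
  \<open>final\<close> and \<open>time\<close>, which replaces rules for single assignments.\<close>

fun straight :: "com \<Rightarrow> bool" where
  "straight (Seq c d) \<longleftrightarrow> straight c \<and> straight d"
| "straight (Cond e f c d) \<longleftrightarrow> straight c \<and> straight d"
| "straight (While e f c) \<longleftrightarrow> False"
| "straight (Check x e lo hi) \<longleftrightarrow> False"
| "straight _ \<longleftrightarrow> True"

fun final :: "com \<Rightarrow> state \<Rightarrow> state" where
  "final (Assign x e f) s = update s x (aval e s) (aval f s)"
| "final (Seq c d) s = final d (final c s)"
| "final (Cond e f c d) s = (if aval e s < aval f s then final c s else final d s)"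
| "final _ s = s"

text \<open>An upper bound, since a conditional counts its dearer branch. The catch-all value is
  right for \<open>Skip\<close> and a mere default for the commands that \<open>straight\<close>
  excludes.\<close>

fun time :: "com \<Rightarrow> nat" where
  "time (Assign x e f) = 1 + cost e + cost f"
| "time (Seq c d) = time c + time d"
| "time (Cond e f c d) = 1 + cost e + cost f + max (time c) (time d)"
| "time _ = 1"

text \<open>Total correctness within a time budget. The existential loses nothing because executions
  are deterministic.\<close>

definition wp :: "'a list list \<Rightarrow> 'a criterion list \<Rightarrow> (nat \<Rightarrow> 'a segment set \<Rightarrow> nat) \<Rightarrow>
    com \<Rightarrow> (state \<Rightarrow> bool) \<Rightarrow> nat \<Rightarrow> state \<Rightarrow> bool" where
  "wp ts Cs ck c Q b s \<longleftrightarrow> (\<exists>t s'. exec ts Cs ck c s t s' \<and> t \<le> b \<and> Q s')"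

lemma wp_mono:
  "wp ts Cs ck c Q b s \<Longrightarrow> (\<And>s'. unchanged (writes c) s s' \<Longrightarrow> Q s' \<Longrightarrow> Q' s') \<Longrightarrow> b \<le> b' \<Longrightarrow>
    wp ts Cs ck c Q' b' s"
  unfolding wp_def using exec_unchanged order_trans by metis

lemma straight_exec:
  "straight c \<Longrightarrow> \<exists>t \<le> time c. exec ts Cs ck c s t (final c s)"
proof (induction c arbitrary: s)
  case (Seq c d)
  obtain t where t: "t \<le> time c" "exec ts Cs ck c s t (final c s)"
    using Seq.IH(1)[of s] Seq.prems by auto
  obtain u where u: "u \<le> time d" "exec ts Cs ck d (final c s) u (final d (final c s))"
    using Seq.IH(2)[of "final c s"] Seq.prems by auto
  show ?case
    by (rule exI[of _ "t + u"]) (use t u exec.Seq[OF t(2) u(2)] in simp)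
next
  case (Cond e f c d)
  show ?case
  proof (cases "aval e s < aval f s")
    case True
    obtain t where t: "t \<le> time c" "exec ts Cs ck c s t (final c s)"
      using Cond.IH(1)[of s] Cond.prems by auto
    show ?thesis
      by (rule exI[of _ "1 + cost e + cost f + t"]) (use True t exec.CondTrue[OF True t(2)] in simp)
  next
    case False
    obtain t where t: "t \<le> time d" "exec ts Cs ck d s t (final d s)"
      using Cond.IH(2)[of s] Cond.prems by auto
    show ?thesis
      by (rule exI[of _ "1 + cost e + cost f + t"]) (use False t exec.CondFalse[OF False t(2)] in simp)
  qed
next
  case Skip
  show ?case by (rule exI[of _ 1]) (simp add: exec.Skip[simplified])
next
  case (Assign x e f)
  show ?case
    by (rule exI[of _ "1 + cost e + cost f"]) (use exec.Assign[of ts Cs ck x e f s] in simp)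
qed simp_all

lemma wp_straight:
  "straight c \<Longrightarrow> Q (final c s) \<Longrightarrow> time c \<le> b \<Longrightarrow> wp ts Cs ck c Q b s"
  unfolding wp_def using straight_exec order_trans by metis

lemma wp_Seq:
  assumes "wp ts Cs ck c R b1 s"
    and "\<And>s'. unchanged (writes c) s s' \<Longrightarrow> R s' \<Longrightarrow> wp ts Cs ck d Q b2 s'"
    and "b1 + b2 \<le> b"
  shows "wp ts Cs ck (Seq c d) Q b s"
proof -
  obtain t s' where 1: "exec ts Cs ck c s t s'" "t \<le> b1" "R s'"
    using assms(1) by (auto simp: wp_def)
  obtain u s'' where 2: "exec ts Cs ck d s' u s''" "u \<le> b2" "Q s''"
    using assms(2)[OF exec_unchanged[OF 1(1)] 1(3)] by (auto simp: wp_def)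
  have "exec ts Cs ck (Seq c d) s (t + u) s''" "t + u \<le> b"
    using 1 2 assms(3) exec.Seq by (auto intro: exec.Seq)
  with 2(3) show ?thesis by (auto simp: wp_def)
qed

lemma wp_Cond:
  assumes "aval e s < aval f s \<Longrightarrow> wp ts Cs ck c Q b s"
    and "\<not> aval e s < aval f s \<Longrightarrow> wp ts Cs ck d Q b s"
    and "1 + cost e + cost f + b \<le> b'"
  shows "wp ts Cs ck (Cond e f c d) Q b' s"
proof (cases "aval e s < aval f s")
  case True
  with assms(1) obtain t s' where "exec ts Cs ck c s t s'" "t \<le> b" "Q s'" by (auto simp: wp_def)
  then show ?thesis unfolding wp_def
    using exec.CondTrue[OF True] assms(3)
    by (intro exI[of _ "1 + cost e + cost f + t"] exI[of _ s']) auto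
next
  case False
  with assms(2) obtain t s' where "exec ts Cs ck d s t s'" "t \<le> b" "Q s'" by (auto simp: wp_def)
  then show ?thesis unfolding wp_def
    using exec.CondFalse[OF False] assms(3)
    by (intro exI[of _ "1 + cost e + cost f + t"] exI[of _ s']) auto
qed

lemma wp_Check:
  assumes "aval e s < length Cs"
    and "\<forall>i < length ts. s lo i \<le> s hi i \<and> s hi i \<le> length (ts ! i)"
    and "1 + cost e + ck (aval e s) (selected ts (s lo) (s hi)) \<le> b"
    and "Q (update s x 0 (if (Cs ! aval e s) (selected ts (s lo) (s hi)) then 1 else 0))"
  shows "wp ts Cs ck (Check x e lo hi) Q b s"
  unfolding wp_def using exec.Check[OF assms(1,2) refl] assms(3,4) by blast

text \<open>The number \<open>N\<close> of rounds is known to the proof in advance, so an invariant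
  indexed by the round replaces a variant. The condition is evaluated \<open>N + 1\<close>
  times.\<close>

lemma wp_While:
  assumes "I 0 s"
    and "\<And>j s'. j < N \<Longrightarrow> I j s' \<Longrightarrow> unchanged (writes c) s s' \<Longrightarrow>
      aval e s' < aval f s' \<and> wp ts Cs ck c (I (Suc j)) b s'"
    and "\<And>s'. I N s' \<Longrightarrow> unchanged (writes c) s s' \<Longrightarrow> \<not> aval e s' < aval f s' \<and> Q s'"
    and "N * (b + 1 + cost e + cost f) + 1 + cost e + cost f \<le> B"
  shows "wp ts Cs ck (While e f c) Q B s"
proof -
  \<comment> \<open>\<open>d\<close> counts the rounds still to come; the frame condition stays
    relative to the initial \<open>s\<close>.\<close>
  have "wp ts Cs ck (While e f c) Q (d * (b + 1 + cost e + cost f) + 1 + cost e + cost f) s'"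
    if "d \<le> N" "I (N - d) s'" "unchanged (writes c) s s'" for d s'
    using that
  proof (induction d arbitrary: s')
    case 0
    then show ?case
      using assms(3)[of s'] exec.WhileFalse[of e s' f ts Cs ck c] by (auto simp: wp_def)
  next
    case (Suc d)
    have *: "aval e s' < aval f s'" "wp ts Cs ck c (I (N - d)) b s'"
      using assms(2)[of "N - Suc d" s'] Suc.prems Suc_diff_Suc[of d N] by auto
    from *(2) obtain t s1 where 1: "exec ts Cs ck c s' t s1" "t \<le> b" "I (N - d) s1"
      by (auto simp: wp_def)
    have "unchanged (writes c) s s1"
      using unchanged_trans[OF Suc.prems(3) exec_unchanged[OF 1(1)]] by simp
    then obtain u s2 where 2: "exec ts Cs ck (While e f c) s1 u s2"
      "u \<le> d * (b + 1 + cost e + cost f) + 1 + cost e + cost f" "Q s2"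
      using Suc.IH[of s1] 1(3) Suc.prems(1) by (auto simp: wp_def)
    then show ?case unfolding wp_def
      using exec.WhileTrue[OF *(1) 1(1) 2(1)] 1(2) by (intro exI conjI) auto
  qed
  from this[of N s] assms(1) unchanged_refl
  have "wp ts Cs ck (While e f c) Q (N * (b + 1 + cost e + cost f) + 1 + cost e + cost f) s"
    by simp
  from wp_mono[OF this _ assms(4)] show ?thesis .
qed

abbreviation Var :: "vname \<Rightarrow> exp" where
  "Var x \<equiv> Cell x (Const 0)"

abbreviation Set :: "vname \<Rightarrow> exp \<Rightarrow> com" where
  "Set x e \<equiv> Assign x (Const 0) e"

definition For :: "vname \<Rightarrow> exp \<Rightarrow> com \<Rightarrow> com" where
  "For x e c = Seq (Set x (Const 0)) (While (Var x) e (Seq c (Set x (Add (Var x) (Const 1)))))"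

lemma writes_For [simp]: "writes (For x e c) = insert x (writes c)"
  by (auto simp: For_def)

text \<open>The body must establish the invariant for the state with the counter already advanced.
  Initialization costs 3, the increment 6 and each test \<open>3 + cost e\<close>, whence the
  constants 9 and 6.\<close>

lemma wp_For:
  assumes "I 0 (update s x 0 0)" and "x \<notin> writes c"
    and body: "\<And>j s'. j < N \<Longrightarrow> I j s' \<Longrightarrow> s' x 0 = j \<Longrightarrow> unchanged (insert x (writes c)) s s' \<Longrightarrow>
      wp ts Cs ck c (\<lambda>s''. I (Suc j) (update s'' x 0 (Suc j))) b s'"
    and limit: "\<And>s'. unchanged (insert x (writes c)) s s' \<Longrightarrow> aval e s' = N"
    and post: "\<And>s'. I N s' \<Longrightarrow> unchanged (insert x (writes c)) s s' \<Longrightarrow> Q s'"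
    and "N * (b + 9 + cost e) + 6 + cost e \<le> B"
  shows "wp ts Cs ck (For x e c) Q B s"
  unfolding For_def
proof (rule wp_Seq[where ?b1.0 = 3 and ?b2.0 = "N * (b + 9 + cost e) + 3 + cost e"])
  show "wp ts Cs ck (Set x (Const 0)) (\<lambda>s'. s' = update s x 0 0) 3 s"
    by (rule wp_straight) auto
next
  fix s1 assume s1: "s1 = update s x 0 0"
  let ?J = "\<lambda>j s'. I j s' \<and> s' x 0 = j"
  let ?c = "Seq c (Set x (Add (Var x) (Const 1)))"
  have un: "unchanged (insert x (writes c)) s s'" if "unchanged (writes ?c) s1 s'" for s'
    using that by (auto simp: unchanged_def s1 update_def)
  show "wp ts Cs ck (While (Var x) e ?c) Q (N * (b + 9 + cost e) + 3 + cost e) s1"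
  proof (rule wp_While[where I = ?J and N = N and b = "b + 6"])
    show "I 0 s1 \<and> s1 x 0 = 0" using assms(1) by (simp add: s1 update_def)
  next
    fix j s' assume A: "j < N" "I j s' \<and> s' x 0 = j" "unchanged (writes ?c) s1 s'"
    have "wp ts Cs ck c (\<lambda>s''. I (Suc j) (update s'' x 0 (Suc j))) b s'"
      using body A un by blast
    then have "wp ts Cs ck ?c (?J (Suc j)) (b + 6) s'"
    proof (rule wp_Seq)
      fix s2 assume "unchanged (writes c) s' s2" "I (Suc j) (update s2 x 0 (Suc j))"
      with A(2) assms(2) show "wp ts Cs ck (Set x (Add (Var x) (Const 1))) (?J (Suc j)) 6 s2"
        by (intro wp_straight) (auto simp: unchanged_def update_def)
    qed simp
    with A limit[OF un] show "aval (Var x) s' < aval e s' \<and> wp ts Cs ck ?c (?J (Suc j)) (b + 6) s'"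
      by simp
  next
    fix s' assume "I N s' \<and> s' x 0 = N" "unchanged (writes ?c) s1 s'"
    with limit[OF un] post un show "\<not> aval (Var x) s' < aval e s' \<and> Q s'" by simp
  qed (simp add: algebra_simps)
qed (use assms in simp)

section \<open>Mixed radix numbers\<close>

text \<open>Digit 0 is the least significant. The function serves twice: with constant radix
  \<open>n + 1\<close> for grid points, and with triangular radices for pairs of them.\<close>

definition mixed_radix :: "(nat \<Rightarrow> nat) \<Rightarrow> nat \<Rightarrow> (nat \<Rightarrow> nat) \<Rightarrow> nat" where
  "mixed_radix D m d = (\<Sum>i<m. d i * (\<Prod>j<i. D j))"

lemma mixed_radix_0 [simp]: "mixed_radix D 0 d = 0"
  by (simp add: mixed_radix_def)

lemma mixed_radix_Suc: "mixed_radix D (Suc m) d = mixed_radix D m d + d m * (\<Prod>j<m. D j)"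
  by (simp add: mixed_radix_def)

lemma mixed_radix_cong: "(\<And>i. i < m \<Longrightarrow> d i = d' i) \<Longrightarrow> mixed_radix D m d = mixed_radix D m d'"
  by (simp add: mixed_radix_def)

lemma mixed_radix_mono: "(\<And>i. i < m \<Longrightarrow> d i \<le> d' i) \<Longrightarrow> mixed_radix D m d \<le> mixed_radix D m d'"
  by (auto simp: mixed_radix_def intro!: sum_mono)

lemma mixed_radix_less:
  "(\<And>i. i < m \<Longrightarrow> d i < D i) \<Longrightarrow> mixed_radix D m d < (\<Prod>j<m. D j)"
proof (induction m)
  case (Suc m)
  let ?P = "\<Prod>j<m. D j"
  have "mixed_radix D (Suc m) d < Suc (d m) * ?P"
    using Suc by (simp add: mixed_radix_Suc)
  also have "\<dots> \<le> D m * ?P"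
    using Suc.prems[of m] by (intro mult_right_mono) auto
  finally show ?case by (simp add: mult.commute)
qed simp

lemma leading_digit_unique:
  fixes a :: nat
  assumes "a < P" "b < P" "a + x * P = b + y * P"
  shows "x = y"
  using arg_cong[OF assms(3), of "\<lambda>z. z div P"] assms(1,2) by simp

lemma mixed_radix_inj:
  assumes "\<And>i. i < m \<Longrightarrow> d i < D i" "\<And>i. i < m \<Longrightarrow> d' i < D i"
    and "mixed_radix D m d = mixed_radix D m d'" "i < m"
  shows "d i = d' i"
  using assms
proof (induction m)
  case (Suc m)
  let ?P = "\<Prod>j<m. D j"
  have l: "mixed_radix D m d < ?P" "mixed_radix D m d' < ?P"
    using Suc.prems(1,2) by (auto intro!: mixed_radix_less)
  have e: "mixed_radix D m d + d m * ?P = mixed_radix D m d' + d' m * ?P"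
    using Suc.prems(3) by (simp add: mixed_radix_Suc)
  have "d m = d' m" using leading_digit_unique[OF l e] .
  moreover from this e have "mixed_radix D m d = mixed_radix D m d'" by simp
  ultimately show ?case using Suc by (cases "i = m") auto
qed simp

text \<open>Triangular numbers: \<open>tri b + a\<close> numbers the pairs \<open>a \<le> b\<close>
  without gaps, by \<open>b\<close> first, and those with \<open>b \<le> l\<close> receive the
  numbers below \<open>tri (Suc l)\<close>.\<close>

fun tri :: "nat \<Rightarrow> nat" where
  "tri 0 = 0"
| "tri (Suc n) = tri n + Suc n"

lemma tri_mono: "a \<le> b \<Longrightarrow> tri a \<le> tri b"
  by (induction b) (auto simp: le_Suc_eq)

lemma double_tri: "2 * tri n = n * (n + 1)"
  by (induction n) auto

lemma tri_pair_less: "a \<le> b \<Longrightarrow> b < b' \<Longrightarrow> tri b + a < tri b'"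
  using tri_mono[of "Suc b" b'] by simp

lemma tri_pair_inj:
  assumes "a \<le> b" "a' \<le> b'" "tri b + a = tri b' + a'"
  shows "a = a' \<and> b = b'"
proof -
  have "b = b'"
    using tri_pair_less[of a b b'] tri_pair_less[of a' b' b] assms by linarith
  with assms show ?thesis by simp
qed

section \<open>Estimates for the running time\<close>

lemma linear_le_exponential: "(m + 1) * 3 ^ m \<le> 2 * 4 ^ (m::nat)"
proof (induction m rule: less_induct)
  case (less m)
  show ?case
  \<comment> \<open>Passing from \<open>m - 1\<close> to \<open>m\<close> multiplies the left side
    by \<open>3 (m + 1) / m\<close>, which is at most 4 from \<open>m = 3\<close> on.\<close>
  proof (cases "m \<le> 2")
    case True
    then have "m = 0 \<or> m = 1 \<or> m = 2" by auto
    then show ?thesis by auto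
  next
    case False
    then obtain p where p: "m = Suc p" "2 \<le> p" by (cases m) auto
    have "(m + 1) * 3 ^ m = (3 * (p + 2)) * 3 ^ p" by (simp add: p(1) algebra_simps)
    also have "\<dots> \<le> (4 * (p + 1)) * 3 ^ p" using p(2) by (intro mult_right_mono) auto
    also have "\<dots> \<le> 4 * (2 * 4 ^ p)"
      unfolding mult.assoc using less[of p] p(1) by (intro mult_left_mono) auto
    finally show ?thesis by (simp add: p(1))
  qed
qed

lemma card_pair_vectors_le:
  assumes "\<And>i. i < m \<Longrightarrow> l i \<le> n" and "1 \<le> n"
  shows "(m + 1) * (\<Prod>i<m. tri (Suc (l i))) \<le> 2 * (n + 1) ^ (2 * m)"
proof -
  \<comment> \<open>With \<open>n * n\<close> hidden in \<open>q\<close>, the inequality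
    \<open>4 * tri (Suc n) \<le> 3 * (n + 1) ^ 2\<close> becomes linear and amounts to
    \<open>1 \<le> q\<close>. It fails for \<open>n = 0\<close>.\<close>
  obtain q where q: "q = n * n" by simp
  have "1 \<le> q" using assms(2) by (simp add: q)
  moreover have "(n + 1) ^ 2 = q + 2 * n + 1" by (simp add: q power2_eq_square)
  moreover have "2 * tri n = q + n" using double_tri[of n] by (simp add: q)
  ultimately have "4 * tri (Suc n) \<le> 3 * (n + 1) ^ 2" by simp
  moreover have "4 * tri (Suc (l i)) \<le> 4 * tri (Suc n)" if "i < m" for i
    using tri_mono[of "Suc (l i)" "Suc n"] assms(1)[OF that] by linarith
  ultimately have "(\<Prod>i<m. 4 * tri (Suc (l i))) \<le> (\<Prod>i<m. 3 * (n + 1) ^ 2)"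
    by (intro prod_mono) (meson lessThan_iff order_trans zero_le)
  then have K: "4 ^ m * (\<Prod>i<m. tri (Suc (l i))) \<le> 3 ^ m * (n + 1) ^ (2 * m)"
    by (simp only: prod.distrib prod_constant card_lessThan power_mult_distrib power_mult)
  have "4 ^ m * ((m + 1) * (\<Prod>i<m. tri (Suc (l i)))) \<le> (m + 1) * (3 ^ m * (n + 1) ^ (2 * m))"
    using mult_le_mono2[OF K, of "m + 1"] by (simp only: mult.left_commute)
  also have "\<dots> = ((m + 1) * 3 ^ m) * (n + 1) ^ (2 * m)" by (simp only: mult.assoc)
  also have "\<dots> \<le> (2 * 4 ^ m) * (n + 1) ^ (2 * m)"
    by (intro mult_right_mono linear_le_exponential) simp
  also have "\<dots> = 4 ^ m * (2 * (n + 1) ^ (2 * m))" by simp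
  finally show ?thesis by simp
qed

text \<open>Pays for computing the powers of \<open>n + 1\<close> by repeated addition. The reason
  is \<open>m \<le> 2 ^ (m - 1)\<close>.\<close>

lemma mult_le_power:
  assumes "1 \<le> n" shows "m * (n + 1) \<le> (n + 1 :: nat) ^ m"
proof (cases m)
  case (Suc p)
  have "Suc p \<le> 2 ^ p" using less_exp[of p] by (rule Suc_leI)
  also have "\<dots> \<le> (n + 1) ^ p" using assms by (intro power_mono) auto
  finally show ?thesis using Suc mult_le_mono1 by (metis mult.commute power_Suc)
qed simp

section \<open>Flow diagrams as chains of cuts\<close>

text \<open>Only coordinates below \<open>length ts\<close> matter. Equality is allowed, so a step
  may leave some or all sequences unmoved.\<close>

definition box :: "'a list list \<Rightarrow> (nat \<Rightarrow> nat) \<Rightarrow> (nat \<Rightarrow> nat) \<Rightarrow> bool" where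
  "box ts a b \<longleftrightarrow> (\<forall>i < length ts. a i \<le> b i \<and> b i \<le> length (ts ! i))"

lemma selected_cong:
  "(\<And>i. i < length ts \<Longrightarrow> a i = a' i) \<Longrightarrow> (\<And>i. i < length ts \<Longrightarrow> b i = b' i) \<Longrightarrow>
    selected ts a b = selected ts a' b'"
  unfolding selected_def by (rule Collect_cong) (metis (full_types))

section \<open>From chains of cuts to flow diagrams\<close>

lemma take_append_slice:
  "a \<le> b \<Longrightarrow> take a xs @ take (b - a) (drop a xs) = take b xs"
  by (metis le_add_diff_inverse take_add)

text \<open>The steps at which one coordinate of a chain advances. Segments being nonempty, the
  sequence visits exactly the nodes of these steps.\<close>

fun jumps :: "(nat \<Rightarrow> nat) \<Rightarrow> nat \<Rightarrow> nat list" where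
  "jumps g 0 = []"
| "jumps g (Suc r) = jumps g r @ (if g r < g (Suc r) then [r] else [])"

lemma set_jumps: "set (jumps g r) = {q. q < r \<and> g q < g (Suc q)}"
  by (induction r) (auto simp: less_Suc_eq)

lemma sorted_jumps: "sorted_wrt (<) (jumps g r)"
  by (induction r) (auto simp: sorted_wrt_append set_jumps)

text \<open>Skipped steps contribute empty slices, so the remaining ones telescope. The second part
  fixes where each segment starts, which \<open>nth_segment\<close> computes from the segments
  before it.\<close>

lemma slices_jumps:
  fixes \<tau> :: "'a list"
  defines "slice g \<equiv> \<lambda>q. take (g (Suc q) - g q) (drop (g q) \<tau>)"
  assumes "g 0 = 0" "\<And>q. q < r \<Longrightarrow> g q \<le> g (Suc q)"
  shows "concat (map (slice g) (jumps g r)) = take (g r) \<tau> \<and>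
    (\<forall>l < length (jumps g r).
      concat (take l (map (slice g) (jumps g r))) = take (g (jumps g r ! l)) \<tau>)"
  using assms(3)
proof (induction r)
  case 0
  then show ?case by (simp add: assms(2))
next
  case (Suc r)
  then have IH: "concat (map (slice g) (jumps g r)) = take (g r) \<tau>"
    "\<And>l. l < length (jumps g r) \<Longrightarrow>
      concat (take l (map (slice g) (jumps g r))) = take (g (jumps g r ! l)) \<tau>"
    by auto
  show ?case
  proof (cases "g r < g (Suc r)")
    case True
    then have "concat (map (slice g) (jumps g (Suc r))) = take (g (Suc r)) \<tau>"
      using IH(1) by (simp add: slice_def take_append_slice)
    moreover have "concat (take l (map (slice g) (jumps g (Suc r)))) = take (g (jumps g (Suc r) ! l)) \<tau>"
      if "l < length (jumps g (Suc r))" for l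
      using that True IH by (cases "l = length (jumps g r)") (auto simp: nth_append)
    ultimately show ?thesis by blast
  next
    case False
    with Suc.prems[of r] have "g (Suc r) = g r" by simp
    with False IH show ?thesis by simp
  qed
qed

text \<open>Step \<open>q\<close> becomes node \<open>r - q\<close>, because the program discovers
  the path from its end. With all forward edges, each sequence can skip the nodes at which it does
  not advance.\<close>

lemma valid_of_chain:
  assumes 0: "\<And>i. i < length ts \<Longrightarrow> w 0 i = 0"
    and r: "\<And>i. i < length ts \<Longrightarrow> w r i = length (ts ! i)"
    and step: "\<And>q. q < r \<Longrightarrow> box ts (w q) (w (Suc q))"
    and crit: "\<And>q. q < r \<Longrightarrow> lab (r - q) < length Cs \<and> (Cs ! lab (r - q)) (selected ts (w q) (w (Suc q)))"
    and nodes: "nodes F = {..<r + 2}" and edges: "edges F = {(a, b). b < a \<and> a < r + 2}"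
    and src: "src F = r + 1" and snk: "snk F = 0" and label: "label F = (\<lambda>v. Cs ! lab v)"
  shows "flow_diagram (set Cs) F" and "valid_for ts F"
proof -
  have internal: "\<exists>q < r. v = r - q" if "v \<in> nodes F - {src F, snk F}" for v
    using that by (intro exI[of _ "r - v"]) (auto simp: nodes src snk)
  have "edges F \<subseteq> less_than\<inverse>" by (auto simp: edges)
  moreover have "acyclic (less_than\<inverse>)" by (simp add: wf_acyclic)
  ultimately have "acyclic (edges F)" by (rule acyclic_subset[rotated])
  moreover have "label F v \<in> set Cs" if "v \<in> nodes F - {src F, snk F}" for v
    using internal[OF that] crit by (auto simp: label)
  ultimately show "flow_diagram (set Cs) F"
    by (auto simp: flow_diagram_def nodes edges src snk)
  define J where "J i = jumps (\<lambda>q. w q i) r" for i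
  define \<sigma> where "\<sigma> i = map (\<lambda>q. take (w (Suc q) i - w q i) (drop (w q i) (ts ! i))) (J i)" for i
  define p where "p i = map (\<lambda>q. r - q) (J i)" for i
  have bound: "w q i \<le> length (ts ! i)" if "i < length ts" "q \<le> r" for q i
    using that step[of q] r by (cases "q = r") (auto simp: box_def intro: le_trans)
  have mono: "w q i \<le> w (Suc q) i" if "i < length ts" "q < r" for q i
    using step[OF that(2)] that(1) by (simp add: box_def)
  have J: "q \<in> set (J i) \<longleftrightarrow> q < r \<and> w q i < w (Suc q) i" for q i
    by (auto simp: J_def set_jumps)
  have slices: "concat (\<sigma> i) = ts ! i"
    "\<And>l. l < length (J i) \<Longrightarrow> concat (take l (\<sigma> i)) = take (w (J i ! l) i) (ts ! i)"
    if "i < length ts" for i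
    using slices_jumps[of "\<lambda>q. w q i" r "ts ! i"] 0 mono that r by (auto simp: \<sigma>_def J_def)
  have segm: "segmentation (ts ! i) (\<sigma> i)" if "i < length ts" for i
  proof -
    have "take (w (Suc q) i - w q i) (drop (w q i) (ts ! i)) \<noteq> []" if "q \<in> set (J i)" for q
      using that J bound[OF \<open>i < length ts\<close>, of "Suc q"] by simp
    then show ?thesis using slices(1)[OF that] by (auto simp: segmentation_def \<sigma>_def)
  qed
  have path: "is_path F (src F # p i @ [snk F])" for i
  proof -
    have "sorted_wrt (\<lambda>a b. b < a) (map (\<lambda>q. r - q) (J i))"
      unfolding sorted_wrt_map
      using sorted_jumps[of "\<lambda>q. w q i" r] J
      by (auto simp: J_def[symmetric] elim!: sorted_wrt_mono_rel[rotated])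
    then have "sorted_wrt (\<lambda>a b. (a, b) \<in> edges F) (src F # p i @ [snk F])"
      using J by (auto simp: sorted_wrt_append p_def src snk edges elim!: sorted_wrt_mono_rel[rotated])
    then show ?thesis unfolding is_path_def by (rule successively_if_sorted_wrt)
  qed
  have joint: "{nth_segment i (\<sigma> i) j | i j. i < length ts \<and> j < length (\<sigma> i) \<and> p i ! j = r - q}
      = selected ts (w q) (w (Suc q))" (is "?L = ?R") if "q < r" for q
  proof (intro equalityI subsetI)
    fix x assume "x \<in> ?L"
    then obtain i j where x: "x = nth_segment i (\<sigma> i) j" "i < length ts" "j < length (J i)"
      "r - J i ! j = r - q" by (auto simp: \<sigma>_def p_def)
    from x(3) have "J i ! j \<in> set (J i)" by simp
    then have "J i ! j < r" "w (J i ! j) i < w (Suc (J i ! j)) i" using J by auto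
    \<comment> \<open>Truncated subtraction from \<open>r\<close> can be cancelled because both
      indices are below \<open>r\<close>.\<close>
    moreover from this x(4) that have "J i ! j = q" by arith
    ultimately have q: "J i ! j = q" "w q i < w (Suc q) i" by auto
    have "length (concat (take j (\<sigma> i))) = w q i"
      using slices(2)[OF x(2,3)] bound[OF x(2), of q] that q by simp
    with x q show "x \<in> ?R" by (auto simp: nth_segment_def selected_def \<sigma>_def)
  next
    fix x assume "x \<in> ?R"
    then obtain i where x: "x = (i, w q i, take (w (Suc q) i - w q i) (drop (w q i) (ts ! i)))"
      "i < length ts" "w q i < w (Suc q) i" by (auto simp: selected_def)
    with that J have "q \<in> set (J i)" by simp
    then obtain j where j: "j < length (J i)" "J i ! j = q" by (auto simp: in_set_conv_nth)
    have "length (concat (take j (\<sigma> i))) = w q i"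
      using slices(2)[OF x(2) j(1)] bound[OF x(2), of q] that j by simp
    with x j have "x = nth_segment i (\<sigma> i) j" "j < length (\<sigma> i)" "p i ! j = r - q"
      by (auto simp: nth_segment_def \<sigma>_def p_def)
    with x(2) show "x \<in> ?L" by blast
  qed
  have "label F v {nth_segment i (\<sigma> i) j | i j. i < length ts \<and> j < length (\<sigma> i) \<and> p i ! j = v}"
    if "v \<in> nodes F - {src F, snk F}" for v
    using internal[OF that] joint crit by (auto simp: label)
  then show "valid_for ts F" unfolding valid_for_def
    using segm path by (intro exI[of _ \<sigma>] exI[of _ p]) (auto simp: p_def \<sigma>_def)
qed

section \<open>From valid flow diagrams to chains of cuts\<close>

lemma acyclic_topological_order:
  assumes "finite A" "finite E" "acyclic (E :: (nat \<times> nat) set)"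
  obtains vs where "set vs = A" "distinct vs"
    "\<And>i j. i < length vs \<Longrightarrow> j < length vs \<Longrightarrow> (vs ! i, vs ! j) \<in> E\<^sup>+ \<Longrightarrow> i < j"
proof -
  \<comment> \<open>The number of proper ancestors increases strictly along edges: \<open>u\<close>
    is an ancestor of \<open>v\<close> but, by acyclicity, not of itself. Sorting by it gives the
    order.\<close>
  define f where "f v = card {u. (u, v) \<in> E\<^sup>+}" for v
  have fin: "finite {u. (u, v) \<in> E\<^sup>+}" for v
  proof (rule finite_subset)
    show "{u. (u, v) \<in> E\<^sup>+} \<subseteq> Domain E" using trancl_domain[of E] by blast
    show "finite (Domain E)" using assms(2) by (rule finite_Domain)
  qed
  have less: "f u < f v" if "(u, v) \<in> E\<^sup>+" for u v
    unfolding f_def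
  proof (rule psubset_card_mono[OF fin])
    have "(u, u) \<notin> E\<^sup>+" using assms(3) by (simp add: acyclic_def)
    with that show "{x. (x, u) \<in> E\<^sup>+} \<subset> {x. (x, v) \<in> E\<^sup>+}" by (auto intro: trancl_trans)
  qed
  define vs where "vs = sort_key f (sorted_list_of_set A)"
  have "sorted (map f vs)" by (simp add: vs_def)
  then have "f (vs ! j) \<le> f (vs ! i)" if "j \<le> i" "i < length vs" for i j
    using that sorted_nth_mono[of "map f vs" j i] by simp
  then have "i < j" if "i < length vs" "j < length vs" "(vs ! i, vs ! j) \<in> E\<^sup>+" for i j
    using less[OF that(3)] that by (meson leD not_le_imp_less)
  then show ?thesis
    using that[of vs] assms(1) by (simp add: vs_def)
qed

lemma down_closed_eq_lessThan:
  assumes "finite A" "\<And>x y. x \<in> A \<Longrightarrow> y < x \<Longrightarrow> y \<in> A"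
  shows "A = {..<card A}"
proof (cases "A = {}")
  case False
  have "x \<in> A \<longleftrightarrow> x < Suc (Max A)" for x
    using assms False Max_in[OF assms(1) False] Max_ge[OF assms(1)]
    by (metis le_eq_less_or_eq less_Suc_eq_le)
  then have "A = {..<Suc (Max A)}" by auto
  then show ?thesis by (metis card_lessThan)
qed simp

text \<open>By transitivity, earlier nodes of the path reach all later ones. So inner nodes have
  predecessors, unlike the source, and successors, unlike the sink. Together with acyclicity, the
  second claim forbids repeated nodes.\<close>

lemma path_internal:
  assumes "flow_diagram \<C> F" "is_path F (src F # p @ [snk F])"
  shows "set p \<subseteq> nodes F - {src F, snk F}"
    and "\<And>i j. i < j \<Longrightarrow> j < length p \<Longrightarrow> (p ! i, p ! j) \<in> (edges F)\<^sup>+"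
proof -
  let ?E = "\<lambda>u v. (u, v) \<in> edges F"
  have "successively (\<lambda>u v. (u, v) \<in> (edges F)\<^sup>+) (src F # p @ [snk F])"
    using assms(2) unfolding is_path_def by (rule successively_mono) auto
  then have st: "sorted_wrt (\<lambda>u v. (u, v) \<in> (edges F)\<^sup>+) (src F # p @ [snk F])"
    by (subst (asm) successively_iff_sorted_wrt_strong) (auto intro: trancl_trans)
  have "(v, snk F) \<in> (edges F)\<^sup>+ \<and> (src F, v) \<in> (edges F)\<^sup>+" if "v \<in> set p" for v
    using st that by (auto simp: sorted_wrt_append)
  then have "v \<in> Domain (edges F) \<and> v \<in> Range (edges F)" if "v \<in> set p" for v
    using that by (metis DomainI RangeI trancl_domain trancl_range)
  then show "set p \<subseteq> nodes F - {src F, snk F}"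
    using assms(1) unfolding flow_diagram_def by fast
  show "(p ! i, p ! j) \<in> (edges F)\<^sup>+" if "i < j" "j < length p" for i j
    using st that sorted_wrt_nth_less[of "\<lambda>u v. (u, v) \<in> (edges F)\<^sup>+" p i j]
    by (simp add: sorted_wrt_append)
qed

text \<open>The witness \<open>w q i\<close> is the length of the part of sequence \<open>i\<close>
  cut off at the first \<open>q\<close> inner nodes in topological order. A node that no path visits
  yields a stationary step.\<close>

lemma chain_of_valid:
  assumes fd: "flow_diagram \<C> F" and "valid_for ts F"
  obtains w where "\<And>i. i < length ts \<Longrightarrow> w 0 i = 0"
    "\<And>i. i < length ts \<Longrightarrow> w (fd_size F - 2) i = length (ts ! i)"
    "\<And>q. q < fd_size F - 2 \<Longrightarrow> box ts (w q) (w (Suc q)) \<and> (\<exists>C \<in> \<C>. C (selected ts (w q) (w (Suc q))))"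
proof -
  let ?A = "nodes F - {src F, snk F}"
  from assms(2) obtain \<sigma> p where
    segm: "\<And>i. i < length ts \<Longrightarrow> segmentation (ts ! i) (\<sigma> i)" and
    len: "\<And>i. i < length ts \<Longrightarrow> length (p i) = length (\<sigma> i)" and
    path: "\<And>i. i < length ts \<Longrightarrow> is_path F (src F # p i @ [snk F])" and
    lab: "\<And>v. v \<in> ?A \<Longrightarrow>
      label F v {nth_segment i (\<sigma> i) j | i j. i < length ts \<and> j < length (\<sigma> i) \<and> p i ! j = v}"
    unfolding valid_for_def by blast
  note F = fd[unfolded flow_diagram_def]
  have "finite (edges F)" using F finite_subset by blast
  then obtain vs where vs: "set vs = ?A" "distinct vs"
    "\<And>i j. i < length vs \<Longrightarrow> j < length vs \<Longrightarrow> (vs ! i, vs ! j) \<in> (edges F)\<^sup>+ \<Longrightarrow> i < j"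
    using acyclic_topological_order[of ?A "edges F"] F by blast
  have size: "length vs = fd_size F - 2"
    using distinct_card[OF vs(2)] vs(1) F by (simp add: fd_size_def card_Diff_subset)
  define L where "L q i = {l. l < length (p i) \<and> p i ! l \<in> set (take q vs)}" for q i
  define w where "w q i = length (concat (take (card (L q i)) (\<sigma> i)))" for q i
  \<comment> \<open>An earlier node of the path is earlier in \<open>vs\<close>, so these positions
    form an initial segment, and its cardinality is the number of segments consumed so far.\<close>
  have L: "L q i = {..<card (L q i)}" if "i < length ts" for q i
  proof (rule down_closed_eq_lessThan)
    show "finite (L q i)" by (simp add: L_def)
  next
    fix x y assume x: "x \<in> L q i" and "y < x"
    then have e: "(p i ! y, p i ! x) \<in> (edges F)\<^sup>+" and "x < length (p i)"
      using path_internal(2)[OF fd path[OF that]] by (auto simp: L_def)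
    with \<open>y < x\<close> have "p i ! y \<in> set vs"
      using path_internal(1)[OF fd path[OF that]] vs(1) by (metis nth_mem order_less_trans subsetD)
    then obtain b where b: "b < length vs" "p i ! y = vs ! b" by (auto simp: in_set_conv_nth)
    from x obtain a where a: "a < length vs" "a < q" "p i ! x = vs ! a"
      by (auto simp: L_def in_set_conv_nth)
    have "b < a" using vs(3)[OF b(1) a(1)] e a b by simp
    then have "p i ! y \<in> set (take q vs)"
      using a b by (auto simp: in_set_conv_nth intro!: exI[of _ b])
    with \<open>y < x\<close> \<open>x < length (p i)\<close> show "y \<in> L q i" by (simp add: L_def)
  qed
  have card_L: "card (L q i) \<le> length (\<sigma> i)" if "i < length ts" for q i
    using card_mono[of "{..<length (p i)}" "L q i"] len[OF that] by (auto simp: L_def)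
  have L_mono: "card (L q i) \<le> card (L (Suc q) i)" for q i
    using set_take_subset_set_take[of q "Suc q" vs] by (intro card_mono) (auto simp: L_def)
  have le: "w q i \<le> w (Suc q) i" for q i
    unfolding w_def using L_mono[of q i]
    by (metis concat_append le_add1 le_Suc_ex length_append take_add)
  have top: "w q i \<le> length (ts ! i)" if "i < length ts" for q i
  proof -
    have "concat (take (card (L q i)) (\<sigma> i)) @ concat (drop (card (L q i)) (\<sigma> i)) = ts ! i"
      using segm[OF that] by (metis append_take_drop_id concat_append segmentation_def)
    then show ?thesis unfolding w_def by (metis le_add1 length_append)
  qed
  show ?thesis
  proof (rule that[of w])
    show "w 0 i = 0" if "i < length ts" for i by (simp add: w_def L_def)
  next
    show "w (fd_size F - 2) i = length (ts ! i)" if "i < length ts" for i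
    proof -
      have "p i ! l \<in> set vs" if "l < length (p i)" for l
        using path_internal(1)[OF fd path[OF \<open>i < length ts\<close>]] that vs(1) by (metis nth_mem subsetD)
      then have "L (length vs) i = {..<length (p i)}" by (auto simp: L_def)
      then show ?thesis
        using segm[OF that] len[OF that] by (simp add: w_def size[symmetric] segmentation_def)
    qed
  next
    fix q assume "q < fd_size F - 2"
    then have q: "q < length vs" by (simp add: size)
    have set_Suc: "set (take (Suc q) vs) = insert (vs ! q) (set (take q vs))"
      using q by (simp add: take_Suc_conv_app_nth)
    have notin: "vs ! q \<notin> set (take q vs)"
      using q vs(2) by (auto simp: in_set_conv_nth nth_eq_iff_index_eq)
    \<comment> \<open>A path meets \<open>vs ! q\<close> at most once, or the node would lie on a
      cycle; hence meeting it adds exactly one position.\<close>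
    have hit: "card (L (Suc q) i) = Suc l \<and> card (L q i) = l"
      if "i < length ts" "l < length (p i)" "p i ! l = vs ! q" for i l
    proof -
      have "l \<in> L (Suc q) i" "l \<notin> L q i" using that notin by (auto simp: L_def set_Suc)
      then have 1: "l < card (L (Suc q) i)" "\<not> l < card (L q i)"
        using L[OF that(1)] by blast+
      have "l' = l" if "l' \<in> L (Suc q) i" "l' \<notin> L q i" for l'
      proof (rule ccontr)
        assume "l' \<noteq> l"
        have *: "p i ! l' = p i ! l" "l' < length (p i)" using that \<open>p i ! l = vs ! q\<close> by (auto simp: L_def set_Suc)
        then have "(p i ! l, p i ! l) \<in> (edges F)\<^sup>+"
          using path_internal(2)[OF fd path[OF \<open>i < length ts\<close>], of l l'] path_internal(2)[OF fd path[OF \<open>i < length ts\<close>], of l' l]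
            \<open>l' \<noteq> l\<close> \<open>l < length (p i)\<close> by (metis linorder_neqE_nat)
        then show False using F by (simp add: acyclic_def)
      qed
      then have 2: "l' = l" if "l' < card (L (Suc q) i)" "\<not> l' < card (L q i)" for l'
        using that L[OF \<open>i < length ts\<close>] by blast
      \<comment> \<open>The nonempty interval between the two cardinalities contains only
        \<open>l\<close>, so its two ends determine both.\<close>
      from 2[of "card (L q i)"] 2[of "card (L (Suc q) i) - 1"] 1 show ?thesis by linarith
    qed
    have miss: "w (Suc q) i = w q i"
      if "i < length ts" "\<And>l. l < length (p i) \<Longrightarrow> p i ! l \<noteq> vs ! q" for i
    proof -
      have "L (Suc q) i = L q i" using that(2) by (auto simp: L_def set_Suc)
      then show ?thesis by (simp add: w_def)
    qed
    have seg: "nth_segment i (\<sigma> i) l = (i, w q i, take (w (Suc q) i - w q i) (drop (w q i) (ts ! i)))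
        \<and> w q i < w (Suc q) i"
      if "i < length ts" "l < length (p i)" "p i ! l = vs ! q" for i l
    proof -
      have l: "l < length (\<sigma> i)" using that len by simp
      have S: "segmentation (ts ! i) (\<sigma> i)" by (rule segm[OF that(1)])
      have "ts ! i = concat (take l (\<sigma> i)) @ \<sigma> i ! l @ concat (drop (Suc l) (\<sigma> i))"
        using S id_take_nth_drop[OF l] by (metis concat.simps(2) concat_append segmentation_def)
      moreover have "w q i = length (concat (take l (\<sigma> i)))"
        "w (Suc q) i = length (concat (take l (\<sigma> i))) + length (\<sigma> i ! l)"
        using hit[OF that] l by (auto simp: w_def take_Suc_conv_app_nth)
      moreover have "\<sigma> i ! l \<noteq> []" using S l by (metis nth_mem segmentation_def)
      ultimately show ?thesis by (simp add: nth_segment_def)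
    qed
    have "{nth_segment i (\<sigma> i) j | i j. i < length ts \<and> j < length (\<sigma> i) \<and> p i ! j = vs ! q}
        = selected ts (w q) (w (Suc q))" (is "?L = ?R")
    proof (intro equalityI subsetI)
      fix x assume "x \<in> ?L"
      then show "x \<in> ?R" using seg len by (auto simp: selected_def)
    next
      fix x assume "x \<in> ?R"
      then obtain i where i: "x = (i, w q i, take (w (Suc q) i - w q i) (drop (w q i) (ts ! i)))"
        "i < length ts" "w q i < w (Suc q) i" by (auto simp: selected_def)
      with miss obtain l where l: "l < length (p i)" "p i ! l = vs ! q" by force
      with seg i len have "x = nth_segment i (\<sigma> i) l" "l < length (\<sigma> i)" by auto
      with i l show "x \<in> ?L" by blast
    qed
    moreover have A: "vs ! q \<in> ?A" using q vs(1) nth_mem by blast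
    ultimately have "label F (vs ! q) (selected ts (w q) (w (Suc q)))" using lab[OF A] by simp
    moreover have "label F (vs ! q) \<in> \<C>" using F A by blast
    ultimately have "\<exists>C \<in> \<C>. C (selected ts (w q) (w (Suc q)))" by blast
    with le top show "box ts (w q) (w (Suc q)) \<and> (\<exists>C \<in> \<C>. C (selected ts (w q) (w (Suc q))))"
      by (simp add: box_def)
  qed
qed

section \<open>The table of shortest paths\<close>

locale short_sequences =
  fixes ts :: "'a list list" and Cs :: "'a criterion list" and n :: nat
  assumes short: "i < length ts \<Longrightarrow> length (ts ! i) \<le> n"
begin

text \<open>Codes are array indices with the origin at 0. A step raises the code unless it is
  stationary, so codes also serve as a topological order of the grid.\<close>

definition code :: "(nat \<Rightarrow> nat) \<Rightarrow> nat" where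
  "code a = mixed_radix (\<lambda>_. n + 1) (length ts) a"

definition rank :: "(nat \<Rightarrow> nat) \<Rightarrow> (nat \<Rightarrow> nat) \<Rightarrow> nat" where
  "rank a b = mixed_radix (\<lambda>i. tri (Suc (length (ts ! i)))) (length ts) (\<lambda>i. tri (b i) + a i)"

definition ranks :: nat where
  "ranks = (\<Prod>i<length ts. tri (Suc (length (ts ! i))))"

abbreviation codes :: nat where
  "codes \<equiv> (n + 1) ^ length ts"

lemma code_less: "(\<And>i. i < length ts \<Longrightarrow> a i \<le> n) \<Longrightarrow> code a < codes"
  unfolding code_def
  using mixed_radix_less[of "length ts" a "\<lambda>_. n + 1"] by (simp add: less_Suc_eq_le)

lemma code_inj:
  assumes "\<And>i. i < length ts \<Longrightarrow> a i \<le> n" "\<And>i. i < length ts \<Longrightarrow> b i \<le> n" "code a = code b"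
    and "i < length ts"
  shows "a i = b i"
  using mixed_radix_inj[of "length ts" a "\<lambda>_. n + 1" b i] assms
  by (simp add: code_def less_Suc_eq_le)

lemma code_mono: "(\<And>i. i < length ts \<Longrightarrow> a i \<le> b i) \<Longrightarrow> code a \<le> code b"
  by (simp add: code_def mixed_radix_mono)

lemma code_cong: "(\<And>i. i < length ts \<Longrightarrow> a i = b i) \<Longrightarrow> code a = code b"
  by (simp add: code_def cong: mixed_radix_cong)

lemma code_zero: "(\<And>i. i < length ts \<Longrightarrow> a i = 0) \<Longrightarrow> code a = 0"
  by (simp add: code_def mixed_radix_def)

lemma box_le_n:
  assumes "box ts a b" "i < length ts" shows "a i \<le> n" "b i \<le> n"
  using assms short[of i] by (auto simp: box_def intro: le_trans)

lemma rank_digit: "box ts a b \<Longrightarrow> i < length ts \<Longrightarrow> tri (b i) + a i < tri (Suc (length (ts ! i)))"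
  by (auto simp: box_def simp del: tri.simps intro!: tri_pair_less)

lemma rank_less: "box ts a b \<Longrightarrow> rank a b < ranks"
  unfolding rank_def ranks_def by (rule mixed_radix_less) (rule rank_digit)

lemma rank_inj:
  assumes "box ts a b" "box ts a' b'" "rank a b = rank a' b'" "i < length ts"
  shows "a i = a' i \<and> b i = b' i"
proof -
  have "tri (b i) + a i = tri (b' i) + a' i"
    using mixed_radix_inj[OF rank_digit[OF assms(1)] rank_digit[OF assms(2)]
        assms(3)[unfolded rank_def] assms(4)] .
  with assms(1,2,4) show ?thesis
    using tri_pair_inj[of "a i" "b i" "a' i" "b' i"] by (simp add: box_def)
qed

text \<open>Edges into a vertex come before the edges out of it.\<close>

lemma rank_consecutive:
  assumes "box ts a b" "box ts b c"
  shows "rank a b \<le> rank b c"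
  unfolding rank_def
  using assms by (intro mixed_radix_mono add_mono tri_mono) (auto simp: box_def)

text \<open>\<open>V x\<close> is the number of codes minus the distance of \<open>x\<close> from the origin, so the initial
  value 0 of a memory cell stands for an unreached vertex; \<open>P\<close> and \<open>X\<close> record the last edge of
  a path and its criterion.\<close>

definition sound :: "(nat \<Rightarrow> nat) \<Rightarrow> (nat \<Rightarrow> nat) \<Rightarrow> (nat \<Rightarrow> nat) \<Rightarrow> bool" where
  "sound V P X \<longleftrightarrow> V 0 = codes \<and> (\<forall>x. V x \<le> codes) \<and>
     (\<forall>x. 0 < x \<longrightarrow> 0 < V x \<longrightarrow> P x < x \<and> V x < V (P x) \<and> X x < length Cs \<and>
        (\<exists>a b. box ts a b \<and> code a = P x \<and> code b = x \<and> (Cs ! X x) (selected ts a b)))"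

text \<open>In terms of distances: the head of an allowed pair is at most one step farther than its
  tail. Truncated subtraction lets an unreached tail, of value 0, impose nothing.\<close>

definition relaxed :: "nat \<Rightarrow> (nat \<Rightarrow> nat) \<Rightarrow> bool" where
  "relaxed t V \<longleftrightarrow> (\<forall>a b c. box ts a b \<longrightarrow> rank a b < t \<longrightarrow> c < length Cs \<longrightarrow>
     (Cs ! c) (selected ts a b) \<longrightarrow> V (code a) - 1 \<le> V (code b))"

lemma sound_init: "sound ((\<lambda>_. 0)(0 := codes)) P X"
  by (simp add: sound_def)

text \<open>Values only grow, so an old pointer into \<open>code hi\<close> still leads to a larger
  value.\<close>

lemma sound_update:
  assumes "sound V P X" "box ts lo hi" "c < length Cs" "(Cs ! c) (selected ts lo hi)"
    and up: "V (code hi) < V (code lo) - 1"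
  shows "sound (V(code hi := V (code lo) - 1)) (P(code hi := code lo)) (X(code hi := c))"
proof -
  have "code lo \<le> code hi" using assms(2) by (auto simp: box_def intro: code_mono)
  \<comment> \<open>Equal codes would contradict \<open>up\<close>. Hence the new pointer leads to a
    smaller code, and the origin is never overwritten.\<close>
  moreover have "code lo \<noteq> code hi" using up by auto
  ultimately have less: "code lo < code hi" by simp
  let ?V = "V(code hi := V (code lo) - 1)"
  let ?P = "P(code hi := code lo)" and ?X = "X(code hi := c)"
  have le: "V x \<le> ?V x" for x using up by simp
  have "V (code lo) - 1 \<le> codes" using assms(1) by (auto simp: sound_def intro: le_trans[OF diff_le_self])
  moreover have "?P x < x \<and> ?V x < ?V (?P x) \<and> ?X x < length Cs \<and>
      (\<exists>a b. box ts a b \<and> code a = ?P x \<and> code b = x \<and> (Cs ! ?X x) (selected ts a b))"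
    if "0 < x" "0 < ?V x" for x
  proof (cases "x = code hi")
    case True
    with less up assms(2-4) show ?thesis by auto
  next
    case False
    with that assms(1) have "P x < x" "V x < V (P x)" "X x < length Cs"
      "\<exists>a b. box ts a b \<and> code a = P x \<and> code b = x \<and> (Cs ! X x) (selected ts a b)"
      by (auto simp: sound_def)
    moreover from this have "V x < ?V (P x)" using le[of "P x"] by linarith
    ultimately show ?thesis using False by simp
  qed
  ultimately show ?thesis
    using assms(1) less unfolding sound_def by simp
qed

text \<open>Pairs leaving \<open>hi\<close> have rank at least \<open>t\<close> by
  \<open>rank_consecutive\<close>, so in the inequalities at stake \<open>code hi\<close> occurs
  only as a head, where a larger value does no harm.\<close>

lemma relaxed_update:
  assumes "relaxed t V" "box ts lo hi" "rank lo hi = t" and up: "V (code hi) \<le> y"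
  shows "relaxed t (V(code hi := y))"
  unfolding relaxed_def
proof (intro allI impI)
  fix a b c
  assume A: "box ts a b" "rank a b < t" "c < length Cs" "(Cs ! c) (selected ts a b)"
  then have "V (code a) - 1 \<le> V (code b)" using assms(1) by (simp add: relaxed_def)
  moreover have "code a \<noteq> code hi"
  proof
    assume "code a = code hi"
    then have eq: "a i = hi i" if "i < length ts" for i
      using code_inj[of a hi i] box_le_n[OF A(1)] box_le_n[OF assms(2)] that by blast
    then have "box ts hi b" using A(1) by (simp add: box_def)
    moreover have "rank a b = rank hi b" unfolding rank_def by (rule mixed_radix_cong) (simp add: eq)
    ultimately show False using rank_consecutive[OF assms(2)] A(2) assms(3) by force
  qed
  ultimately show "(V(code hi := y)) (code a) - 1 \<le> (V(code hi := y)) (code b)"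
    using up by auto
qed

text \<open>By \<open>rank_inj\<close>, the pair just processed is the only one of rank
  \<open>t\<close>, up to coordinates beyond the input.\<close>

lemma relaxed_Suc:
  assumes "relaxed t V" "box ts lo hi" "rank lo hi = t"
    and "\<And>c. c < length Cs \<Longrightarrow> (Cs ! c) (selected ts lo hi) \<Longrightarrow> V (code lo) - 1 \<le> V (code hi)"
  shows "relaxed (Suc t) V"
  unfolding relaxed_def
proof (intro allI impI)
  fix a b c
  assume A: "box ts a b" "rank a b < Suc t" "c < length Cs" "(Cs ! c) (selected ts a b)"
  show "V (code a) - 1 \<le> V (code b)"
  proof (cases "rank a b < t")
    case True
    with A assms(1) show ?thesis by (simp add: relaxed_def)
  next
    case False
    with A(2) assms(3) have "rank a b = rank lo hi" by simp
    then have eq: "a i = lo i" "b i = hi i" if "i < length ts" for i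
      using rank_inj[OF A(1) assms(2)] that by auto
    have "selected ts a b = selected ts lo hi" by (rule selected_cong) (simp_all add: eq)
    moreover have "code a = code lo" "code b = code hi" by (rule code_cong, simp add: eq)+
    ultimately show ?thesis using assms(4) A(3,4) by simp
  qed
qed

section \<open>Optimality of the value at the target\<close>

definition target :: nat where
  "target = code (\<lambda>i. length (ts ! i))"

lemma target_less: "target < codes"
  unfolding target_def using short by (rule code_less)

text \<open>The codes along a path increase strictly, so a target of value 0 is really unreachable.\<close>

lemma lower_bound:
  assumes "sound V P X" "relaxed ranks V" "flow_diagram (set Cs) F" "valid_for ts F"
  shows "0 < V target" and "codes \<le> V target + (fd_size F - 2)"
proof -
  obtain w where w: "\<And>i. i < length ts \<Longrightarrow> w 0 i = 0"
    "\<And>i. i < length ts \<Longrightarrow> w (fd_size F - 2) i = length (ts ! i)"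
    "\<And>q. q < fd_size F - 2 \<Longrightarrow>
      box ts (w q) (w (Suc q)) \<and> (\<exists>C \<in> set Cs. C (selected ts (w q) (w (Suc q))))"
    using chain_of_valid[OF assms(3,4)] by blast
  \<comment> \<open>In effect \<open>d\<close> counts the moving steps so far. Each of them raises
    the code, whence \<open>d \<le> code (w q)\<close>; at the target this gives
    \<open>d < codes\<close> and so a positive value.\<close>
  have "\<exists>d \<le> q. d \<le> code (w q) \<and> codes \<le> V (code (w q)) + d" if "q \<le> fd_size F - 2" for q
    using that
  proof (induction q)
    case 0
    have "code (w 0) = 0" using w(1) by (rule code_zero)
    with assms(1) show ?case by (simp add: sound_def)
  next
    case (Suc q)
    then obtain d where d: "d \<le> q" "d \<le> code (w q)" "codes \<le> V (code (w q)) + d" by auto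
    from w(3)[of q] Suc.prems obtain c where c: "box ts (w q) (w (Suc q))" "c < length Cs"
      "(Cs ! c) (selected ts (w q) (w (Suc q)))"
      by (auto simp: in_set_conv_nth)
    then have step: "V (code (w q)) - 1 \<le> V (code (w (Suc q)))"
      using assms(2) rank_less by (auto simp: relaxed_def)
    have "code (w q) \<le> code (w (Suc q))" using c(1) by (auto simp: box_def intro: code_mono)
    with d step show ?case
      by (cases "code (w q) = code (w (Suc q))") (auto intro: exI[of _ d] exI[of _ "Suc d"])
  qed
  from this[of "fd_size F - 2"] obtain d where d: "d \<le> fd_size F - 2"
    "d \<le> code (w (fd_size F - 2))" "codes \<le> V (code (w (fd_size F - 2))) + d" by auto
  moreover have "code (w (fd_size F - 2)) = target" unfolding target_def using w(2) by (rule code_cong)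
  ultimately show "0 < V target" "codes \<le> V target + (fd_size F - 2)"
    using target_less by auto
qed

text \<open>Along the pointers codes fall, which forces arrival at the origin, and values rise up to
  \<open>codes\<close>, which bounds the number of steps.\<close>

lemma back_pointers:
  assumes "sound V P X" "0 < V target"
  obtains r where "(P ^^ r) target = 0" "\<And>j. j < r \<Longrightarrow> 0 < (P ^^ j) target" "r + V target \<le> codes"
    "\<And>j. j \<le> r \<Longrightarrow> 0 < V ((P ^^ j) target)"
proof -
  have *: "V target + j \<le> V ((P ^^ j) target) \<and> (P ^^ j) target + j \<le> target"
    if "\<And>i. i < j \<Longrightarrow> 0 < (P ^^ i) target" for j
    using that
  proof (induction j)
    case (Suc j)
    let ?x = "(P ^^ j) target"
    have "V target + j \<le> V ?x" "?x + j \<le> target" using Suc by auto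
    moreover have "P ?x < ?x \<and> V ?x < V (P ?x)"
      using assms Suc.prems[of j] calculation by (simp add: sound_def)
    ultimately show ?case by simp
  qed simp
  have ex: "\<exists>j. (P ^^ j) target = 0"
  proof (rule ccontr)
    assume "\<nexists>j. (P ^^ j) target = 0"
    with *[of "Suc target"] show False by simp
  qed
  define r where "r = (LEAST j. (P ^^ j) target = 0)"
  have r: "(P ^^ r) target = 0" unfolding r_def using ex by (rule LeastI_ex)
  have pos: "0 < (P ^^ j) target" if "j < r" for j
    using not_less_Least that unfolding r_def by blast
  have val: "V target + j \<le> V ((P ^^ j) target)" if "j \<le> r" for j
    using *[of j] pos that by simp
  show ?thesis
    using that[OF r pos] val[of r] val assms r by (force simp: sound_def)
qed

text \<open>The traced path has at most \<open>codes - V target\<close> steps, and by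
  \<open>lower_bound\<close> every valid diagram has at least as many inner nodes.\<close>

lemma minimum_of_pointers:
  assumes "sound V P X" "relaxed ranks V" "0 < V target"
    and "(P ^^ r) target = 0" "\<And>j. j < r \<Longrightarrow> 0 < (P ^^ j) target" "r + V target \<le> codes"
    and "\<And>j. j \<le> r \<Longrightarrow> 0 < V ((P ^^ j) target)"
    and lab: "\<And>j. j < r \<Longrightarrow> lab (Suc j) = X ((P ^^ j) target)"
    and F: "nodes F = {..<r + 2}" "edges F = {(a, b). b < a \<and> a < r + 2}"
      "src F = r + 1" "snk F = 0" "label F = (\<lambda>v. Cs ! lab v)"
  shows "minimum_valid ts (set Cs) F"
proof -
  let ?x = "\<lambda>j. (P ^^ j) target"
  have "\<exists>a b. box ts a b \<and> code a = ?x (Suc j) \<and> code b = ?x j \<and>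
      X (?x j) < length Cs \<and> (Cs ! X (?x j)) (selected ts a b)" if "j < r" for j
    using assms(1) assms(5,7)[of j] that unfolding sound_def by force
  then obtain A B where AB: "\<And>j. j < r \<Longrightarrow> box ts (A j) (B j) \<and> code (A j) = ?x (Suc j) \<and>
      code (B j) = ?x j \<and> X (?x j) < length Cs \<and> (Cs ! X (?x j)) (selected ts (A j) (B j))"
    by metis
  \<comment> \<open>The endpoints chosen for consecutive edges agree only in their codes.
    \<open>u\<close> fixes one vector per vertex of the path, and injectivity of codes glues the
    edges together.\<close>
  define u where "u j = (case j of 0 \<Rightarrow> (\<lambda>i. length (ts ! i)) | Suc j \<Rightarrow> A j)" for j
  have u_Suc: "u (Suc j) = A j" for j by (simp add: u_def)
  have code_u: "code (u j) = ?x j" if "j \<le> r" for j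
    using that AB[of "j - 1"] by (cases j) (auto simp: u_def target_def)
  have u_le: "u j i \<le> n" if "j \<le> r" "i < length ts" for i j
    using that AB[of "j - 1"] box_le_n short by (cases j) (auto simp: u_def)
  have u_B: "B j i = u j i" if "j < r" "i < length ts" for i j
    using code_inj[of "B j" "u j" i] AB[OF that(1)] box_le_n(2) code_u[of j] u_le[of j] that by force
  have u_0: "u r i = 0" if "i < length ts" for i
    using code_inj[of "u r" "\<lambda>_. 0" i] u_le[of r] code_u[of r] assms(4) code_zero[of "\<lambda>_. 0"] that by simp
  have step: "box ts (u (Suc j)) (u j)" if "j < r" for j
    using AB[OF that] u_B[OF that] by (simp add: u_Suc box_def)
  have crit: "X (?x j) < length Cs \<and> (Cs ! X (?x j)) (selected ts (u (Suc j)) (u j))" if "j < r" for j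
    using AB[OF that] selected_cong[of ts "A j" "A j" "B j" "u j"] u_B[OF that] by (simp add: u_Suc)
  have r: "r - q = Suc (r - Suc q)" if "q < r" for q using that by simp
  have fd: "flow_diagram (set Cs) F" and valid: "valid_for ts F"
    using valid_of_chain[of ts "\<lambda>q. u (r - q)" r lab Cs F] u_0 step crit lab F r
    by (simp_all add: u_def)
  have "fd_size F \<le> fd_size F'" if "flow_diagram (set Cs) F'" "valid_for ts F'" for F'
  proof -
    from that(1) have "finite (nodes F')" "{src F', snk F'} \<subseteq> nodes F'" "src F' \<noteq> snk F'"
      by (auto simp: flow_diagram_def)
    then have "2 \<le> fd_size F'" using card_mono[of "nodes F'" "{src F', snk F'}"] by (simp add: fd_size_def)
    moreover have "codes \<le> V target + (fd_size F' - 2)" using lower_bound[OF assms(1,2) that] by simp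
    ultimately show ?thesis using assms(6) by (simp add: fd_size_def F)
  qed
  with fd valid show ?thesis by (simp add: minimum_valid_def)
qed

end

section \<open>The program\<close>

abbreviation At :: "vname \<Rightarrow> vname \<Rightarrow> exp" where
  "At x i \<equiv> Cell x (Var i)"

abbreviation Put :: "vname \<Rightarrow> vname \<Rightarrow> exp \<Rightarrow> com" where
  "Put x i e \<equiv> Assign x (Var i) e"

abbreviation Inc :: "exp \<Rightarrow> exp" where
  "Inc e \<equiv> Add e (Const 1)"

notation Seq (infixr \<open>;;\<close> 55)

text \<open>\<open>x\<close> starts at \<open>W\<close> and receives \<open>W\<close> another
  \<open>n\<close> times, so each round multiplies \<open>W\<close> by \<open>n + 1\<close>; its
  last value is the number of codes.\<close>

definition weights :: com where
  "weights = Set ''W'' (Const 1) ;;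
     For ''i'' (Var ''m'')
       ((Put ''w'' ''i'' (Var ''W'') ;; Set ''x'' (Var ''W'')) ;;
        For ''j'' (Var ''n'') (Set ''x'' (Add (Var ''x'') (Var ''W''))) ;;
        Set ''W'' (Var ''x''))"

text \<open>One step of a mixed radix counter whose digits are the pairs \<open>lo i \<le> hi i\<close>, ordered by
  \<open>hi i\<close> first. The arrays \<open>wl\<close> and \<open>wh\<close> hold the digits times their weights, which replaces
  multiplication.\<close>

definition odometer_digit :: com where
  "odometer_digit =
     Cond (Const 0) (Var ''cy'')
       (Cond (At ''lo'' ''i'') (At ''hi'' ''i'')
         (Put ''lo'' ''i'' (Inc (At ''lo'' ''i'')) ;;
          Put ''wl'' ''i'' (Add (At ''wl'' ''i'') (At ''w'' ''i'')) ;; Set ''cy'' (Const 0))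
         (Put ''lo'' ''i'' (Const 0) ;; Put ''wl'' ''i'' (Const 0) ;;
          Cond (At ''hi'' ''i'') (At ''len'' ''i'')
            (Put ''hi'' ''i'' (Inc (At ''hi'' ''i'')) ;;
             Put ''wh'' ''i'' (Add (At ''wh'' ''i'') (At ''w'' ''i'')) ;; Set ''cy'' (Const 0))
            (Put ''hi'' ''i'' (Const 0) ;; Put ''wh'' ''i'' (Const 0))))
       Skip ;;
     Set ''cl'' (Add (Var ''cl'') (At ''wl'' ''i'')) ;;
     Set ''ch'' (Add (Var ''ch'') (At ''wh'' ''i''))"

text \<open>Adding 1 means entering the least significant digit with carry 1. A carry left at the
  end tells that the last pair has been passed.\<close>

definition odometer :: com where
  "odometer = (Set ''cy'' (Const 1) ;; Set ''cl'' (Const 0) ;; Set ''ch'' (Const 0)) ;;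
     For ''i'' (Var ''m'') odometer_digit"

definition improve :: com where
  "improve = Cond (Const 0) (Var ''ans'')
     (Cond (At ''val'' ''ch'') (Sub (At ''val'' ''cl'') (Const 1))
       (Put ''pred'' ''ch'' (Var ''cl'') ;; Put ''crit'' ''ch'' (Var ''c'') ;;
        Put ''val'' ''ch'' (Sub (At ''val'' ''cl'') (Const 1)))
       Skip)
     Skip"

definition relax :: com where
  "relax = For ''c'' (Var ''k'') (Check ''ans'' (Var ''c'') ''lo'' ''hi'' ;; improve)"

text \<open>The zeros of the initial memory encode the first pair, from the origin to itself. The
  last pair ends at the vector of lengths, so \<open>tg\<close> finally holds the target.\<close>

definition search :: com where
  "search = weights ;; Set ''val'' (Var ''W'') ;;
     While (Var ''cy'') (Const 1) (Set ''tg'' (Var ''ch'') ;; relax ;; odometer)"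

definition add_edges :: com where
  "add_edges = For ''j'' (Var ''i'')
     (Put ''tail'' ''edges'' (Var ''i'') ;; Put ''head'' ''edges'' (Var ''j'') ;;
      Set ''edges'' (Inc (Var ''edges'')))"

text \<open>The path is traced back from the target, so nodes are numbered from the sink 0 upwards.\<close>

definition trace_back :: com where
  "trace_back = Cond (Const 0) (At ''val'' ''tg'')
     ((Set ''x'' (Var ''tg'') ;; Set ''i'' (Const 1)) ;;
      While (Const 0) (Var ''x'')
        ((Put ''label'' ''i'' (At ''crit'' ''x'') ;; Set ''x'' (At ''pred'' ''x'')) ;;
         add_edges ;; Set ''i'' (Inc (Var ''i''))) ;;
      add_edges ;;
      Set ''src'' (Var ''i'') ;; Set ''nodes'' (Inc (Var ''i'')))
     Skip"

text \<open>For \<open>n = 0\<close> there is no time to look at all \<open>m\<close> sequences.\<close>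

definition program :: com where
  "program = Cond (Const 0) (Var ''n'') search (Set ''val'' (Const 1)) ;; trace_back"

section \<open>Verification\<close>

text \<open>Adds the incoming carry to a digit of radix \<open>tri (Suc l)\<close>: raise the lower
  end, else reset it and raise the upper end, else reset both and pass the carry on as
  \<open>c\<close>.\<close>

lemma final_digit:
  assumes "s ''i'' 0 = i" "s ''len'' i = l" "s ''lo'' i \<le> s ''hi'' i" "s ''hi'' i \<le> l"
    and "s ''w'' i = W" "s ''wl'' i = s ''lo'' i * W" "s ''wh'' i = s ''hi'' i * W" "s ''cy'' 0 \<le> 1"
  obtains a b c where
    "final odometer_digit s ''lo'' = (s ''lo'')(i := a)"
    "final odometer_digit s ''hi'' = (s ''hi'')(i := b)"
    "final odometer_digit s ''wl'' = (s ''wl'')(i := a * W)"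
    "final odometer_digit s ''wh'' = (s ''wh'')(i := b * W)"
    "final odometer_digit s ''cl'' 0 = s ''cl'' 0 + a * W"
    "final odometer_digit s ''ch'' 0 = s ''ch'' 0 + b * W"
    "final odometer_digit s ''cy'' 0 = c"
    "a \<le> b" "b \<le> l" "c \<le> 1" "c = 1 \<longrightarrow> s ''cy'' 0 = 1 \<and> s ''hi'' i = l"
    "tri b + a + c * tri (Suc l) = tri (s ''hi'' i) + s ''lo'' i + s ''cy'' 0"
proof -
  consider (stop) "s ''cy'' 0 = 0" | (lo) "s ''cy'' 0 = 1" "s ''lo'' i < s ''hi'' i"
    | (hi) "s ''cy'' 0 = 1" "s ''lo'' i = s ''hi'' i" "s ''hi'' i < l"
    | (carry) "s ''cy'' 0 = 1" "s ''lo'' i = l" "s ''hi'' i = l"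
    using assms(3,4,8) by linarith
  then show ?thesis
  proof cases
    case stop
    show ?thesis
      by (rule that[of "s ''lo'' i" "s ''hi'' i" 0])
        (use stop assms in \<open>simp_all add: odometer_digit_def update_def fun_upd_idem add.commute\<close>)
  next
    case lo
    show ?thesis
      by (rule that[of "Suc (s ''lo'' i)" "s ''hi'' i" 0])
        (use lo assms in \<open>simp_all add: odometer_digit_def update_def fun_upd_idem add.commute\<close>)
  next
    case hi
    show ?thesis
      by (rule that[of 0 "Suc (s ''hi'' i)" 0])
        (use hi assms in \<open>simp_all add: odometer_digit_def update_def add.commute\<close>)
  next
    case carry
    show ?thesis
      by (rule that[of 0 0 1])
        (use carry assms in \<open>simp_all add: odometer_digit_def update_def\<close>)
  qed
qed

locale instance_with_checks = short_sequences ts Cs n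
  for ts :: "'a list list" and Cs :: "'a criterion list" and n :: nat +
  fixes ck :: "nat \<Rightarrow> 'a segment set \<Rightarrow> nat" and T :: nat
  assumes check_time: "check_time_bound ts (length Cs) ck (length ts) n T"
begin

abbreviation triple :: "com \<Rightarrow> (state \<Rightarrow> bool) \<Rightarrow> nat \<Rightarrow> state \<Rightarrow> bool" where
  "triple \<equiv> wp ts Cs ck"

text \<open>A selection contains at most one segment per sequence, so the assumed bound on check
  times applies.\<close>

lemma ck_le:
  assumes "box ts lo hi" "c < length Cs"
  shows "ck c (selected ts lo hi) \<le> T"
proof -
  let ?S = "selected ts lo hi"
  have img: "?S \<subseteq> (\<lambda>i. (i, lo i, take (hi i - lo i) (drop (lo i) (ts ! i)))) ` {..<length ts}"
    by (auto simp: selected_def)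
  have "card ?S \<le> length ts" using surj_card_le[OF _ img] by simp
  moreover have "?S \<subseteq> segments ts"
  proof
    fix x assume "x \<in> ?S"
    then obtain i where x: "x = (i, lo i, take (hi i - lo i) (drop (lo i) (ts ! i)))"
      "i < length ts" "lo i < hi i" by (auto simp: selected_def)
    have len: "hi i \<le> length (ts ! i)" using assms(1) x(2) by (simp add: box_def)
    have "ts ! i = take (lo i) (ts ! i) @ take (hi i - lo i) (drop (lo i) (ts ! i)) @ drop (hi i) (ts ! i)"
      by (metis append.assoc append_take_drop_id less_imp_le take_append_slice x(3))
    moreover have "length (take (lo i) (ts ! i)) = lo i" using x(3) len by simp
    ultimately have "\<exists>ys zs. ts ! i = ys @ take (hi i - lo i) (drop (lo i) (ts ! i)) @ zs \<and> length ys = lo i"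
      by blast
    with x len show "x \<in> segments ts" by (simp add: segments_def)
  qed
  moreover have "\<forall>(i, a, xs) \<in> ?S. length xs \<le> n"
    using short by (fastforce simp: selected_def)
  ultimately show ?thesis using check_time assms(2) unfolding check_time_bound_def by blast
qed

definition input :: "state \<Rightarrow> bool" where
  "input s \<longleftrightarrow> s ''m'' 0 = length ts \<and> s ''n'' 0 = n \<and> s ''k'' 0 = length Cs \<and>
     (\<forall>i < length ts. s ''len'' i = length (ts ! i))"

lemma input_unchanged:
  "input s \<Longrightarrow> unchanged X s s' \<Longrightarrow> X \<inter> {''m'', ''n'', ''k'', ''len''} = {} \<Longrightarrow> input s'"
  by (auto simp: input_def unchanged_def)

lemma weights_correct:
  assumes "input s"
  shows "triple weights (\<lambda>s'. (\<forall>i < length ts. s' ''w'' i = (n + 1) ^ i) \<and> s' ''W'' 0 = codes)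
    (40 * (length ts * (n + 1)) + 12) s"
  unfolding weights_def
proof (rule wp_Seq[where R = "\<lambda>s'. s' ''W'' 0 = 1" and ?b1.0 = 4])
  show "triple (Set ''W'' (Const 1)) (\<lambda>s'. s' ''W'' 0 = 1) 4 s"
    by (rule wp_straight) (auto simp: update_def)
next
  fix s1 assume un1: "unchanged (writes (Set ''W'' (Const 1))) s s1" and W1: "s1 ''W'' 0 = 1"
  have in1: "input s1" using input_unchanged[OF assms un1] by simp
  let ?I = "\<lambda>j s'. (\<forall>i < j. s' ''w'' i = (n + 1) ^ i) \<and> s' ''W'' 0 = (n + 1) ^ j"
  let ?c1 = "Put ''w'' ''i'' (Var ''W'') ;; Set ''x'' (Var ''W'')"
  let ?c2 = "For ''j'' (Var ''n'') (Set ''x'' (Add (Var ''x'') (Var ''W'')))"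
  show "triple (For ''i'' (Var ''m'') (?c1 ;; ?c2 ;; Set ''W'' (Var ''x'')))
    (\<lambda>s'. (\<forall>i < length ts. s' ''w'' i = (n + 1) ^ i) \<and> s' ''W'' 0 = codes)
    (40 * (length ts * (n + 1)) + 8) s1"
  proof (rule wp_For[where I = ?I and N = "length ts" and b = "18 * n + 21"])
    show "?I 0 (update s1 ''i'' 0 0)" using W1 by (simp add: update_def)
  next
    fix j s2 assume j: "j < length ts" and I: "?I j s2" "s2 ''i'' 0 = j"
      and un2: "unchanged (insert ''i'' (writes (?c1 ;; ?c2 ;; Set ''W'' (Var ''x'')))) s1 s2"
    have in2: "input s2" using input_unchanged[OF in1 un2] by simp
    let ?Q = "\<lambda>s'. ?I (Suc j) (update s' ''i'' 0 (Suc j))"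
    show "triple (?c1 ;; ?c2 ;; Set ''W'' (Var ''x'')) ?Q (18 * n + 21) s2"
    proof (rule wp_Seq[where R = "\<lambda>s'. s' = final ?c1 s2" and ?b1.0 = 9])
      show "triple ?c1 (\<lambda>s'. s' = final ?c1 s2) 9 s2" by (rule wp_straight) auto
    next
      fix s3 assume s3: "s3 = final ?c1 s2"
      show "triple (?c2 ;; Set ''W'' (Var ''x'')) ?Q (18 * n + 12) s3"
      proof (rule wp_Seq[where R = "\<lambda>s'. s' ''x'' 0 = (n + 1) ^ Suc j" and ?b1.0 = "18 * n + 8"])
        show "triple ?c2 (\<lambda>s'. s' ''x'' 0 = (n + 1) ^ Suc j) (18 * n + 8) s3"
        proof (rule wp_For[where I = "\<lambda>p s'. s' ''x'' 0 = (p + 1) * (n + 1) ^ j" and N = n and b = 7])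
          fix p s4 assume "s4 ''x'' 0 = (p + 1) * (n + 1) ^ j"
            "unchanged (insert ''j'' (writes (Set ''x'' (Add (Var ''x'') (Var ''W''))))) s3 s4"
          then show "triple (Set ''x'' (Add (Var ''x'') (Var ''W'')))
             (\<lambda>s'. update s' ''j'' 0 (Suc p) ''x'' 0 = (Suc p + 1) * (n + 1) ^ j) 7 s4"
            using I(1) by (intro wp_straight) (auto simp: update_def unchanged_def s3)
        qed (use in2 I(1) in \<open>auto simp: update_def unchanged_def s3 input_def\<close>)
      next
        fix s4 assume "unchanged (writes ?c2) s3 s4" "s4 ''x'' 0 = (n + 1) ^ Suc j"
        then show "triple (Set ''W'' (Var ''x'')) ?Q 4 s4"
          using I by (intro wp_straight) (auto simp: update_def unchanged_def s3 less_Suc_eq)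
      qed simp
    qed simp
  next
    fix s' assume "unchanged (insert ''i'' (writes (?c1 ;; ?c2 ;; Set ''W'' (Var ''x'')))) s1 s'"
    from input_unchanged[OF in1 this] show "aval (Var ''m'') s' = length ts" by (simp add: input_def)
  next
    have "length ts * (18 * n + 21 + 9 + 2) \<le> length ts * (40 * (n + 1))" by (intro mult_le_mono2) simp
    then show "length ts * (18 * n + 21 + 9 + cost (Var ''m'')) + 6 + cost (Var ''m'')
      \<le> 40 * (length ts * (n + 1)) + 8" by (simp add: algebra_simps)
  qed simp_all
qed simp

definition vectors :: "state \<Rightarrow> bool" where
  "vectors s \<longleftrightarrow> box ts (s ''lo'') (s ''hi'') \<and>
     (\<forall>i < length ts. s ''w'' i = (n + 1) ^ i \<and> s ''wl'' i = s ''lo'' i * (n + 1) ^ i \<and>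
        s ''wh'' i = s ''hi'' i * (n + 1) ^ i)"

lemma odometer_correct:
  assumes "input s" "vectors s"
  shows "triple odometer (\<lambda>s'. vectors s' \<and> s' ''cl'' 0 = code (s' ''lo'') \<and> s' ''ch'' 0 = code (s' ''hi'') \<and>
      s' ''cy'' 0 \<le> 1 \<and> (s' ''cy'' 0 = 1 \<longrightarrow> (\<forall>i < length ts. s ''hi'' i = length (ts ! i))) \<and>
      rank (s' ''lo'') (s' ''hi'') + s' ''cy'' 0 * ranks = rank (s ''lo'') (s ''hi'') + 1)
    (100 * (length ts + 1)) s"
  unfolding odometer_def
proof -
  let ?c1 = "Set ''cy'' (Const 1) ;; Set ''cl'' (Const 0) ;; Set ''ch'' (Const 0)"
  let ?D = "\<lambda>i. tri (Suc (length (ts ! i)))" and ?B = "\<lambda>_::nat. n + 1"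
  \<comment> \<open>After \<open>i\<close> digits, the new low part plus the weighted carry equals
    the old low part plus 1, while the higher digits are untouched.\<close>
  let ?I = "\<lambda>i s'. (\<forall>j \<ge> i. s' ''lo'' j = s ''lo'' j \<and> s' ''hi'' j = s ''hi'' j \<and>
        s' ''wl'' j = s ''wl'' j \<and> s' ''wh'' j = s ''wh'' j) \<and>
      (\<forall>j < i. s' ''lo'' j \<le> s' ''hi'' j \<and> s' ''hi'' j \<le> length (ts ! j) \<and>
        s' ''wl'' j = s' ''lo'' j * (n + 1) ^ j \<and> s' ''wh'' j = s' ''hi'' j * (n + 1) ^ j) \<and>
      s' ''cl'' 0 = mixed_radix ?B i (s' ''lo'') \<and> s' ''ch'' 0 = mixed_radix ?B i (s' ''hi'') \<and>
      s' ''cy'' 0 \<le> 1 \<and> (s' ''cy'' 0 = 1 \<longrightarrow> (\<forall>j < i. s ''hi'' j = length (ts ! j))) \<and>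
      mixed_radix ?D i (\<lambda>j. tri (s' ''hi'' j) + s' ''lo'' j) + s' ''cy'' 0 * (\<Prod>j<i. ?D j) =
      mixed_radix ?D i (\<lambda>j. tri (s ''hi'' j) + s ''lo'' j) + 1"
  let ?Q = "\<lambda>s'. vectors s' \<and> s' ''cl'' 0 = code (s' ''lo'') \<and> s' ''ch'' 0 = code (s' ''hi'') \<and>
      s' ''cy'' 0 \<le> 1 \<and> (s' ''cy'' 0 = 1 \<longrightarrow> (\<forall>i < length ts. s ''hi'' i = length (ts ! i))) \<and>
      rank (s' ''lo'') (s' ''hi'') + s' ''cy'' 0 * ranks = rank (s ''lo'') (s ''hi'') + 1"
  have wr: "writes odometer_digit = {''lo'', ''hi'', ''wl'', ''wh'', ''cy'', ''cl'', ''ch''}"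
    by (auto simp: odometer_digit_def)
  show "triple (?c1 ;; For ''i'' (Var ''m'') odometer_digit) ?Q (100 * (length ts + 1)) s"
  proof (rule wp_Seq[where R = "\<lambda>s'. s' = final ?c1 s" and ?b1.0 = 9])
    show "triple ?c1 (\<lambda>s'. s' = final ?c1 s) 9 s" by (rule wp_straight) auto
  next
    fix s1 assume s1: "s1 = final ?c1 s"
    show "triple (For ''i'' (Var ''m'') odometer_digit) ?Q (100 * length ts + 8) s1"
    proof (rule wp_For[where I = ?I and N = "length ts" and b = 89])
      show "?I 0 (update s1 ''i'' 0 0)" by (simp add: s1 update_def)
      show "''i'' \<notin> writes odometer_digit" by (simp add: wr)
    next
      fix i s2 assume i: "i < length ts" and I: "?I i s2" "s2 ''i'' 0 = i"
        and un: "unchanged (insert ''i'' (writes odometer_digit)) s1 s2"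
      have "input s2" "s2 ''w'' = s ''w''"
        using un assms(1) by (auto simp: unchanged_def wr s1 update_def input_def)
      then have len: "s2 ''len'' i = length (ts ! i)" and w: "s2 ''w'' i = (n + 1) ^ i"
        using i assms(2) by (auto simp: input_def vectors_def)
      have eq: "s2 ''lo'' i = s ''lo'' i" "s2 ''hi'' i = s ''hi'' i" "s2 ''wl'' i = s ''wl'' i"
        "s2 ''wh'' i = s ''wh'' i" "s2 ''cy'' 0 \<le> 1" using I by auto
      have le: "s2 ''lo'' i \<le> s2 ''hi'' i" "s2 ''hi'' i \<le> length (ts ! i)"
        "s2 ''wl'' i = s2 ''lo'' i * (n + 1) ^ i" "s2 ''wh'' i = s2 ''hi'' i * (n + 1) ^ i"
        using assms(2) i unfolding eq by (auto simp: vectors_def box_def)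
      obtain a b c where f:
        "final odometer_digit s2 ''lo'' = (s2 ''lo'')(i := a)"
        "final odometer_digit s2 ''hi'' = (s2 ''hi'')(i := b)"
        "final odometer_digit s2 ''wl'' = (s2 ''wl'')(i := a * (n + 1) ^ i)"
        "final odometer_digit s2 ''wh'' = (s2 ''wh'')(i := b * (n + 1) ^ i)"
        "final odometer_digit s2 ''cl'' 0 = s2 ''cl'' 0 + a * (n + 1) ^ i"
        "final odometer_digit s2 ''ch'' 0 = s2 ''ch'' 0 + b * (n + 1) ^ i"
        "final odometer_digit s2 ''cy'' 0 = c"
        and ab: "a \<le> b" "b \<le> length (ts ! i)" "c \<le> 1" "c = 1 \<longrightarrow> s2 ''cy'' 0 = 1 \<and> s2 ''hi'' i = length (ts ! i)"
        "tri b + a + c * ?D i = tri (s2 ''hi'' i) + s2 ''lo'' i + s2 ''cy'' 0"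
        by (rule final_digit[OF I(2) len le(1,2) w le(3,4) eq(5)])
      have cong1: "mixed_radix E i (x(i := y)) = mixed_radix E i x" for E x y
        by (rule mixed_radix_cong) simp
      have cong2: "mixed_radix ?D i (\<lambda>j. tri (((s2 ''hi'')(i := b)) j) + ((s2 ''lo'')(i := a)) j)
          = mixed_radix ?D i (\<lambda>j. tri (s2 ''hi'' j) + s2 ''lo'' j)"
        by (rule mixed_radix_cong) simp
      let ?P = "\<Prod>j<i. ?D j"
      \<comment> \<open>The digit equation times the weight of the digit; combined with the
        invariant, it eliminates the incoming carry.\<close>
      have "(tri b + a) * ?P + c * (?D i * ?P) = (tri (s ''hi'' i) + s ''lo'' i) * ?P + s2 ''cy'' 0 * ?P"
        using arg_cong[OF ab(5), of "\<lambda>x. x * ?P"] unfolding eq by (simp only: add_mult_distrib mult.assoc)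
      then have rank_eq: "mixed_radix ?D (Suc i) (\<lambda>j. tri (((s2 ''hi'')(i := b)) j) + ((s2 ''lo'')(i := a)) j)
          + c * (\<Prod>j<Suc i. ?D j) = mixed_radix ?D (Suc i) (\<lambda>j. tri (s ''hi'' j) + s ''lo'' j) + 1"
        using I(1) unfolding mixed_radix_Suc cong2 prod.lessThan_Suc
        by (simp del: tri.simps add: mult.commute)
      show "triple odometer_digit (\<lambda>s'. ?I (Suc i) (update s' ''i'' 0 (Suc i))) 89 s2"
      proof (rule wp_straight)
        show "?I (Suc i) (update (final odometer_digit s2) ''i'' 0 (Suc i))"
          using I(1) ab rank_eq eq
          by (simp add: update_def f mixed_radix_Suc cong1 less_Suc_eq all_conj_distrib
              del: tri.simps prod.lessThan_Suc)
      qed (simp_all add: odometer_digit_def)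
    next
      fix s' assume "unchanged (insert ''i'' (writes odometer_digit)) s1 s'"
      then show "aval (Var ''m'') s' = length ts"
        using assms(1) by (simp add: unchanged_def wr s1 update_def input_def)
    next
      fix s' assume I: "?I (length ts) s'" and un: "unchanged (insert ''i'' (writes odometer_digit)) s1 s'"
      have "s' ''w'' = s ''w''" using un by (simp add: unchanged_def wr s1 update_def)
      with I assms(2) show "?Q s'"
        by (simp add: vectors_def box_def code_def rank_def ranks_def del: tri.simps)
    qed simp
  qed simp
qed

abbreviation sound_state :: "state \<Rightarrow> bool" where
  "sound_state s \<equiv> sound (s ''val'') (s ''pred'') (s ''crit'')"

text \<open>The inequality of the current pair is secured criterion by criterion; then
  \<open>relaxed_Suc\<close> advances the rank.\<close>

lemma relax_correct:
  assumes "input s" "box ts (s ''lo'') (s ''hi'')" "rank (s ''lo'') (s ''hi'') = t"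
    and "s ''cl'' 0 = code (s ''lo'')" "s ''ch'' 0 = code (s ''hi'')"
    and "sound_state s" "relaxed t (s ''val'')"
  shows "triple relax (\<lambda>s'. sound_state s' \<and> relaxed (Suc t) (s' ''val''))
    (length Cs * (T + 60) + 8) s"
  unfolding relax_def
proof -
  let ?lo = "code (s ''lo'')" and ?hi = "code (s ''hi'')"
  let ?S = "selected ts (s ''lo'') (s ''hi'')"
  let ?I = "\<lambda>c s'. sound_state s' \<and> relaxed t (s' ''val'') \<and>
      (\<forall>d < c. (Cs ! d) ?S \<longrightarrow> s' ''val'' ?lo - 1 \<le> s' ''val'' ?hi)"
  let ?c = "Check ''ans'' (Var ''c'') ''lo'' ''hi'' ;; improve"
  have wr: "writes improve = {''pred'', ''crit'', ''val''}"
    by (auto simp: improve_def)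
  show "triple (For ''c'' (Var ''k'') ?c) (\<lambda>s'. sound_state s' \<and> relaxed (Suc t) (s' ''val''))
    (length Cs * (T + 60) + 8) s"
  proof (rule wp_For[where I = ?I and N = "length Cs" and b = "T + 49"])
    show "?I 0 (update s ''c'' 0 0)" using assms(6,7) by (simp add: update_def)
    show "''c'' \<notin> writes ?c" by (simp add: wr)
  next
    fix c s1 assume c: "c < length Cs" and I: "?I c s1" "s1 ''c'' 0 = c"
      and "unchanged (insert ''c'' (writes ?c)) s s1"
    then have same: "s1 ''lo'' = s ''lo''" "s1 ''hi'' = s ''hi''" "s1 ''cl'' = s ''cl''" "s1 ''ch'' = s ''ch''"
      by (auto simp: unchanged_def wr)
    show "triple ?c (\<lambda>s'. ?I (Suc c) (update s' ''c'' 0 (Suc c))) (T + 49) s1"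
    proof (rule wp_Seq[where R = "\<lambda>s'. s' = update s1 ''ans'' 0 (if (Cs ! c) ?S then 1 else 0)"
          and ?b1.0 = "T + 3" and ?b2.0 = 46])
      show "triple (Check ''ans'' (Var ''c'') ''lo'' ''hi'')
          (\<lambda>s'. s' = update s1 ''ans'' 0 (if (Cs ! c) ?S then 1 else 0)) (T + 3) s1"
        using c I(2) ck_le[OF assms(2) c] assms(2)
        by (intro wp_Check) (simp_all add: same box_def)
    next
      fix s2 assume s2: "s2 = update s1 ''ans'' 0 (if (Cs ! c) ?S then 1 else 0)"
      have I2: "sound_state s2" "relaxed t (s2 ''val'')"
        "\<And>d. d < c \<Longrightarrow> (Cs ! d) ?S \<Longrightarrow> s2 ''val'' ?lo - 1 \<le> s2 ''val'' ?hi"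
        using I(1) by (auto simp: s2 update_def)
      have v2: "s2 ''c'' 0 = c" "s2 ''cl'' 0 = ?lo" "s2 ''ch'' 0 = ?hi" "0 < s2 ''ans'' 0 \<longleftrightarrow> (Cs ! c) ?S"
        using I(2) assms(4,5) same by (auto simp: s2 update_def)
      show "triple improve (\<lambda>s'. ?I (Suc c) (update s' ''c'' 0 (Suc c))) 46 s2"
      proof (rule wp_straight)
        show "?I (Suc c) (update (final improve s2) ''c'' 0 (Suc c))"
        proof (cases "(Cs ! c) ?S \<and> s2 ''val'' ?hi < s2 ''val'' ?lo - 1")
          case True
          then have f: "final improve s2 ''val'' = (s2 ''val'')(?hi := s2 ''val'' ?lo - 1)"
            "final improve s2 ''pred'' = (s2 ''pred'')(?hi := ?lo)"
            "final improve s2 ''crit'' = (s2 ''crit'')(?hi := c)"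
            using v2 by (simp_all add: improve_def update_def)
          \<comment> \<open>The update thus keeps the value at \<open>?lo\<close>, and the
            inequality of this pair now holds with equality for all criteria.\<close>
          have "?lo \<noteq> ?hi" using True by auto
          with True show ?thesis
            using sound_update[OF I2(1) assms(2) c, of] relaxed_update[OF I2(2) assms(2,3), of "s2 ''val'' ?lo - 1"]
            by (simp add: f update_def)
        next
          case False
          then have f: "final improve s2 = s2"
            using v2 by (simp add: improve_def)
          show ?thesis using False I2 by (auto simp: f update_def less_Suc_eq)
        qed
      qed (simp_all add: improve_def)
    qed simp
  next
    fix s' assume "unchanged (insert ''c'' (writes ?c)) s s'"
    from input_unchanged[OF assms(1) this] show "aval (Var ''k'') s' = length Cs"
      by (simp add: wr input_def)
  next
    fix s' assume "?I (length Cs) s'"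
    then show "sound_state s' \<and> relaxed (Suc t) (s' ''val'')"
      using relaxed_Suc[OF _ assms(2,3)] by blast
  qed (simp add: algebra_simps)
qed

lemma search_correct:
  assumes "input s" "1 \<le> n" "1 \<le> length Cs" "1 \<le> T"
    and zero: "\<And>x. x \<notin> {''m'', ''n'', ''k'', ''len''} \<Longrightarrow> s x = (\<lambda>_. 0)"
  shows "triple search (\<lambda>s'. sound_state s' \<and> relaxed ranks (s' ''val'') \<and> s' ''tg'' 0 = target)
    (500 * ((n + 1) ^ (2 * length ts) * length Cs * T)) s"
  unfolding search_def
proof -
  let ?w = "\<lambda>s'. (\<forall>i < length ts. s' ''w'' i = (n + 1) ^ i) \<and> s' ''W'' 0 = codes"
  let ?Q = "\<lambda>s'. sound_state s' \<and> relaxed ranks (s' ''val'') \<and> s' ''tg'' 0 = target"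
  let ?m = "length ts" and ?k = "length Cs"
  let ?c = "Set ''tg'' (Var ''ch'') ;; relax ;; odometer"
  \<comment> \<open>Before round \<open>t < ranks\<close> the current pair has rank
    \<open>t\<close>; at \<open>t = ranks\<close> the counter has overflowed.\<close>
  let ?I = "\<lambda>t s'. vectors s' \<and> sound_state s' \<and> relaxed t (s' ''val'') \<and>
      s' ''cl'' 0 = code (s' ''lo'') \<and> s' ''ch'' 0 = code (s' ''hi'') \<and>
      (if t < ranks then s' ''cy'' 0 = 0 \<and> rank (s' ''lo'') (s' ''hi'') = t
       else s' ''cy'' 0 = 1 \<and> s' ''tg'' 0 = target)"
  let ?b = "?k * (T + 60) + 100 * (?m + 1) + 12"
  have wr: "writes weights = {''W'', ''i'', ''w'', ''x'', ''j''}"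
    "writes relax = {''c'', ''ans'', ''pred'', ''crit'', ''val''}"
    "writes odometer = {''cy'', ''cl'', ''ch'', ''i'', ''lo'', ''hi'', ''wl'', ''wh''}"
    by (auto simp: weights_def relax_def improve_def odometer_def odometer_digit_def)
  have "0 < ranks" using rank_less[of "\<lambda>_. 0" "\<lambda>_. 0"] by (simp add: box_def)
  have kT: "1 \<le> ?k * T" using assms(3,4) by simp
  \<comment> \<open>Per pair, the checks cost at most 61 and the rest 116 times
    \<open>(m + 1) * k * T\<close>. Over all pairs, \<open>card_pair_vectors_le\<close> trades
    \<open>m + 1\<close> for a factor 2, whence 354.\<close>
  have "?k * (T + 60) \<le> 61 * (?k * T)"
    using mult_le_mono2[of "T + 60" "61 * T" ?k] assms(4) by (simp add: algebra_simps)
  moreover have "?k * T \<le> (?m + 1) * (?k * T)" by simp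
  moreover have "100 * (?m + 1) + 16 \<le> 116 * ((?m + 1) * (?k * T))"
    using mult_le_mono2[OF kT, of "116 * (?m + 1)"] by (simp add: algebra_simps)
  ultimately have "?b + 4 \<le> 177 * ((?m + 1) * (?k * T))" by linarith
  then have "ranks * (?b + 4) \<le> ranks * (177 * ((?m + 1) * (?k * T)))" by (rule mult_le_mono2)
  also have "\<dots> = 177 * ((?m + 1) * ranks * (?k * T))" by (simp only: ac_simps)
  also have "\<dots> \<le> 177 * (2 * (n + 1) ^ (2 * ?m) * (?k * T))"
    unfolding ranks_def
    by (intro mult_le_mono2 mult_le_mono1 card_pair_vectors_le short assms(2))
  finally have loop: "ranks * (?b + 4) \<le> 354 * ((n + 1) ^ (2 * ?m) * (?k * T))" by simp
  have "?m * (n + 1) \<le> (n + 1) ^ ?m" using assms(2) by (rule mult_le_power)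
  also have "\<dots> \<le> (n + 1) ^ (2 * ?m)" by (rule power_increasing) auto
  also have "\<dots> \<le> (n + 1) ^ (2 * ?m) * (?k * T)" using kT by simp
  finally have preparation: "?m * (n + 1) \<le> (n + 1) ^ (2 * ?m) * (?k * T)" .
  have "1 \<le> (n + 1) ^ (2 * ?m) * (?k * T)" using kT by simp
  with loop preparation have time: "(40 * (?m * (n + 1)) + 12) + (4 + (ranks * (?b + 4) + 4))
      \<le> 500 * ((n + 1) ^ (2 * ?m) * ?k * T)"
    by (simp only: mult.assoc)
  show "triple (weights ;; Set ''val'' (Var ''W'') ;; While (Var ''cy'') (Const 1) ?c) ?Q
      (500 * ((n + 1) ^ (2 * ?m) * ?k * T)) s"
  proof (rule wp_Seq[OF weights_correct[OF assms(1)] _ time])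
    fix s1 assume un1: "unchanged (writes weights) s s1" and w1: "?w s1"
    have z1: "s1 ''val'' = (\<lambda>_. 0)" "s1 ''lo'' = (\<lambda>_. 0)" "s1 ''hi'' = (\<lambda>_. 0)" "s1 ''wl'' = (\<lambda>_. 0)"
      "s1 ''wh'' = (\<lambda>_. 0)" "s1 ''cl'' = (\<lambda>_. 0)" "s1 ''ch'' = (\<lambda>_. 0)" "s1 ''cy'' = (\<lambda>_. 0)"
      using un1 zero by (simp_all add: unchanged_def wr)
    show "triple (Set ''val'' (Var ''W'') ;; While (Var ''cy'') (Const 1) ?c) ?Q
        (4 + (ranks * (?b + 4) + 4)) s1"
    proof (rule wp_Seq[where R = "\<lambda>s'. s' = update s1 ''val'' 0 codes" and ?b1.0 = 4])
      show "triple (Set ''val'' (Var ''W'')) (\<lambda>s'. s' = update s1 ''val'' 0 codes) 4 s1"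
        using w1 by (intro wp_straight) auto
    next
      fix s2 assume s2: "s2 = update s1 ''val'' 0 codes"
      have in2: "input s2"
        using assms(1) un1 by (simp add: s2 update_def input_def unchanged_def wr)
      show "triple (While (Var ''cy'') (Const 1) ?c) ?Q (ranks * (?b + 4) + 4) s2"
      proof (rule wp_While[where I = ?I and N = ranks and b = ?b])
        have "rank (\<lambda>_. 0) (\<lambda>_. 0) = 0" "code (\<lambda>_. 0) = 0"
          by (simp_all add: rank_def code_def mixed_radix_def)
        then show "?I 0 s2"
          using w1 \<open>0 < ranks\<close> sound_init
          by (simp add: s2 update_def z1 vectors_def box_def relaxed_def)
      next
        fix t s3 assume t: "t < ranks" and I: "?I t s3" and un: "unchanged (writes ?c) s2 s3"
        have in3: "input s3" using input_unchanged[OF in2 un] by (simp add: wr)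
        have "triple ?c (?I (Suc t)) ?b s3"
        proof (rule wp_Seq[where R = "\<lambda>s'. s' = update s3 ''tg'' 0 (code (s3 ''hi''))" and ?b1.0 = 4])
          show "triple (Set ''tg'' (Var ''ch'')) (\<lambda>s'. s' = update s3 ''tg'' 0 (code (s3 ''hi''))) 4 s3"
            using I by (intro wp_straight) auto
        next
          fix s4 assume s4: "s4 = update s3 ''tg'' 0 (code (s3 ''hi''))"
          have in4: "input s4" using in3 by (simp add: s4 update_def input_def)
          have I4: "box ts (s4 ''lo'') (s4 ''hi'')" "rank (s4 ''lo'') (s4 ''hi'') = t"
            "s4 ''cl'' 0 = code (s4 ''lo'')" "s4 ''ch'' 0 = code (s4 ''hi'')"
            "sound_state s4" "relaxed t (s4 ''val'')" "vectors s4" "s4 ''tg'' 0 = code (s4 ''hi'')"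
            using I t by (simp_all add: s4 update_def vectors_def)
          show "triple (relax ;; odometer) (?I (Suc t)) (?k * (T + 60) + 100 * (?m + 1) + 8) s4"
          proof (rule wp_Seq[OF relax_correct[OF in4 I4(1-6)]])
            fix s5 assume un5: "unchanged (writes relax) s4 s5"
              and R5: "sound_state s5 \<and> relaxed (Suc t) (s5 ''val'')"
            have in5: "input s5" using input_unchanged[OF in4 un5] by (simp add: wr)
            have same: "s5 ''lo'' = s4 ''lo''" "s5 ''hi'' = s4 ''hi''" "s5 ''tg'' = s4 ''tg''"
              using un5 by (simp_all add: unchanged_def wr)
            have v5: "vectors s5" using un5 I4(7) by (simp add: unchanged_def wr vectors_def)
            show "triple odometer (?I (Suc t)) (100 * (?m + 1)) s5"
            proof (rule wp_mono[OF odometer_correct[OF in5 v5]])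
              fix s6 assume "unchanged (writes odometer) s5 s6"
              then have same6: "s6 ''val'' = s5 ''val''" "s6 ''pred'' = s5 ''pred''"
                "s6 ''crit'' = s5 ''crit''" "s6 ''tg'' = s5 ''tg''"
                by (simp_all add: unchanged_def wr)
              assume O: "vectors s6 \<and> s6 ''cl'' 0 = code (s6 ''lo'') \<and> s6 ''ch'' 0 = code (s6 ''hi'') \<and>
                s6 ''cy'' 0 \<le> 1 \<and> (s6 ''cy'' 0 = 1 \<longrightarrow> (\<forall>i < ?m. s5 ''hi'' i = length (ts ! i))) \<and>
                rank (s6 ''lo'') (s6 ''hi'') + s6 ''cy'' 0 * ranks = rank (s5 ''lo'') (s5 ''hi'') + 1"
              \<comment> \<open>Since ranks stay below \<open>ranks\<close>, the carry is 0 exactly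
                if \<open>Suc t < ranks\<close>.\<close>
              have r6: "rank (s6 ''lo'') (s6 ''hi'') < ranks"
                using O by (auto simp: vectors_def intro: rank_less)
              have eq: "rank (s6 ''lo'') (s6 ''hi'') + s6 ''cy'' 0 * ranks = Suc t"
                using O I4(2) same by simp
              have "s6 ''cy'' 0 = 0 \<or> s6 ''cy'' 0 = 1" using O by linarith
              then have "if Suc t < ranks then s6 ''cy'' 0 = 0 \<and> rank (s6 ''lo'') (s6 ''hi'') = Suc t
                 else s6 ''cy'' 0 = 1 \<and> s6 ''tg'' 0 = target"
              proof
                assume "s6 ''cy'' 0 = 0"
                with eq r6 show ?thesis by simp
              next
                assume cy: "s6 ''cy'' 0 = 1"
                with O have "code (s5 ''hi'') = target" unfolding target_def by (intro code_cong) auto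
                then have "s6 ''tg'' 0 = target" using I4(8) same same6 by simp
                with cy eq show ?thesis by simp
              qed
              with O R5 same6 show "?I (Suc t) s6" by simp
            qed simp
          qed simp
        qed simp
        with I t show "aval (Var ''cy'') s3 < aval (Const 1) s3 \<and> triple ?c (?I (Suc t)) ?b s3"
          by simp
      next
        fix s' assume "?I ranks s'"
        then show "\<not> aval (Var ''cy'') s' < aval (Const 1) s' \<and> ?Q s'" by simp
      qed simp
    qed simp
  qed
qed

section \<open>Writing out the flow diagram\<close>

definition edge_set :: "state \<Rightarrow> (nat \<times> nat) set" where
  "edge_set s = {(s ''tail'' j, s ''head'' j) | j. j < s ''edges'' 0}"

lemma edge_set_image: "edge_set s = (\<lambda>j. (s ''tail'' j, s ''head'' j)) ` {..<s ''edges'' 0}"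
  by (auto simp: edge_set_def)

lemma add_edges_correct:
  assumes "s ''i'' 0 = v" "edge_set s = {(a, b). b < a \<and> a < v}"
  shows "triple add_edges (\<lambda>s'. edge_set s' = {(a, b). b < a \<and> a < Suc v}) (27 * v + 8) s"
  unfolding add_edges_def
proof -
  let ?c = "Put ''tail'' ''edges'' (Var ''i'') ;; Put ''head'' ''edges'' (Var ''j'') ;;
      Set ''edges'' (Inc (Var ''edges''))"
  let ?I = "\<lambda>j s'. edge_set s' = {(a, b). b < a \<and> a < v} \<union> {(v, b) | b. b < j}"
  show "triple (For ''j'' (Var ''i'') ?c) (\<lambda>s'. edge_set s' = {(a, b). b < a \<and> a < Suc v}) (27 * v + 8) s"
  proof (rule wp_For[where I = ?I and N = v and b = 16])
    show "?I 0 (update s ''j'' 0 0)" using assms(2) by (simp add: edge_set_def update_def)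
  next
    fix j s1 assume I: "?I j s1" "s1 ''j'' 0 = j" and "unchanged (insert ''j'' (writes ?c)) s s1"
    then have i: "s1 ''i'' 0 = v" using assms(1) by (simp add: unchanged_def)
    have "edge_set (update (final ?c s1) ''j'' 0 (Suc j)) = insert (v, j) (edge_set s1)"
      unfolding edge_set_image
      by (simp add: update_def i I(2) lessThan_Suc)
    also have "\<dots> = {(a, b). b < a \<and> a < v} \<union> {(v, b) | b. b < Suc j}"
      using I(1) by (auto simp: less_Suc_eq)
    finally show "triple ?c (\<lambda>s'. ?I (Suc j) (update s' ''j'' 0 (Suc j))) 16 s1"
      by (intro wp_straight) simp_all
  next
    fix s' assume "?I v s'"
    then show "edge_set s' = {(a, b). b < a \<and> a < Suc v}" by (auto simp: less_Suc_eq)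
  qed (use assms(1) in \<open>auto simp: unchanged_def\<close>)
qed

definition solution :: "state \<Rightarrow> bool" where
  "solution s \<longleftrightarrow> (case result Cs s of
       None \<Rightarrow> \<nexists>F. flow_diagram (set Cs) F \<and> valid_for ts F
     | Some F \<Rightarrow> minimum_valid ts (set Cs) F)"

lemma trace_back_correct:
  assumes "sound_state s" "relaxed ranks (s ''val'')" "s ''tg'' 0 = target"
    and zero: "s ''edges'' 0 = 0" "s ''nodes'' 0 = 0" "s ''snk'' 0 = 0"
  shows "triple trace_back solution (200 * (codes * codes)) s"
  unfolding trace_back_def
proof (rule wp_Cond[where b = "190 * (codes * codes)"])
  assume "\<not> aval (Const 0) s < aval (At ''val'' ''tg'') s"
  then have "\<not> 0 < s ''val'' target" by (simp add: assms(3))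
  \<comment> \<open>\<open>nodes\<close> keeps its initial 0, which \<open>result\<close> reads as
    the absence of a valid diagram.\<close>
  then have "solution s" using lower_bound(1)[OF assms(1,2)] zero(2) by (auto simp: solution_def result_def)
  then show "triple Skip solution (190 * (codes * codes)) s" by (intro wp_straight) auto
next
  assume "aval (Const 0) s < aval (At ''val'' ''tg'') s"
  then have pos: "0 < s ''val'' target" by (simp add: assms(3))
  let ?P = "s ''pred''" and ?X = "s ''crit''"
  obtain r where r: "(?P ^^ r) target = 0" "\<And>j. j < r \<Longrightarrow> 0 < (?P ^^ j) target"
    "r + s ''val'' target \<le> codes" "\<And>j. j \<le> r \<Longrightarrow> 0 < s ''val'' ((?P ^^ j) target)"
    using back_pointers[OF assms(1) pos] by blast
  let ?begin = "Set ''x'' (Var ''tg'') ;; Set ''i'' (Const 1)"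
  let ?c1 = "Put ''label'' ''i'' (At ''crit'' ''x'') ;; Set ''x'' (At ''pred'' ''x'')"
  let ?c = "?c1 ;; add_edges ;; Set ''i'' (Inc (Var ''i''))"
  let ?d = "Set ''src'' (Var ''i'') ;; Set ''nodes'' (Inc (Var ''i''))"
  \<comment> \<open>After \<open>q\<close> rounds, \<open>x\<close> lies \<open>q\<close> edges
    before the target, and the next node to be numbered is \<open>Suc q\<close>, as 0 is the
    sink.\<close>
  let ?I = "\<lambda>q s'. s' ''x'' 0 = (?P ^^ q) target \<and> s' ''i'' 0 = Suc q \<and>
      (\<forall>j < q. s' ''label'' (Suc j) = ?X ((?P ^^ j) target)) \<and>
      edge_set s' = {(a, b). b < a \<and> a < Suc q}"
  have wr: "writes add_edges = {''j'', ''tail'', ''head'', ''edges''}"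
    by (auto simp: add_edges_def)
  \<comment> \<open>The edges are quadratic in number, and a positive value at the target leaves
    room for one more than \<open>r\<close>.\<close>
  have "Suc r \<le> codes" using r(3) pos by simp
  then have "Suc r * Suc r \<le> codes * codes" by (intro mult_le_mono)
  then have "190 * (Suc r * Suc r) \<le> 190 * (codes * codes)" by (rule mult_le_mono2)
  moreover have "8 + ((r * (27 * r + 56) + 4) + ((27 * Suc r + 8) + 10)) \<le> 190 * (Suc r * Suc r)"
    by (simp add: algebra_simps)
  ultimately have time: "8 + ((r * (27 * r + 56) + 4) + ((27 * Suc r + 8) + 10)) \<le> 190 * (codes * codes)"
    by (rule le_trans[rotated])
  show "triple (?begin ;; While (Const 0) (Var ''x'') ?c ;; add_edges ;; ?d) solution (190 * (codes * codes)) s"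
  proof (rule wp_Seq[where R = "\<lambda>s'. s' = final ?begin s", OF _ _ time])
    show "triple ?begin (\<lambda>s'. s' = final ?begin s) 8 s" by (rule wp_straight) auto
  next
    fix s1 assume s1: "s1 = final ?begin s"
    show "triple (While (Const 0) (Var ''x'') ?c ;; add_edges ;; ?d) solution
        ((r * (27 * r + 56) + 4) + ((27 * Suc r + 8) + 10)) s1"
    proof (rule wp_Seq[where R = "?I r" and ?b1.0 = "r * (27 * r + 56) + 4"])
      show "triple (While (Const 0) (Var ''x'') ?c) (?I r) (r * (27 * r + 56) + 4) s1"
      proof (rule wp_While[where I = ?I and N = r and b = "27 * r + 52"])
        show "?I 0 s1" using assms(3) zero(1) by (auto simp: s1 update_def edge_set_def)
      next
        fix q s2 assume q: "q < r" and I: "?I q s2" and un: "unchanged (writes ?c) s1 s2"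
        have same: "s2 ''crit'' = ?X" "s2 ''pred'' = ?P"
          using un by (simp_all add: unchanged_def wr s1 update_def)
        have "triple ?c (?I (Suc q)) (27 * r + 52) s2"
        proof (rule wp_Seq[where R = "\<lambda>s'. s' = final ?c1 s2" and ?b1.0 = 12])
          show "triple ?c1 (\<lambda>s'. s' = final ?c1 s2) 12 s2" by (rule wp_straight) auto
        next
          fix s3 assume s3: "s3 = final ?c1 s2"
          show "triple (add_edges ;; Set ''i'' (Inc (Var ''i''))) (?I (Suc q)) (27 * r + 40) s3"
          proof (rule wp_Seq[OF add_edges_correct[where v = "Suc q"]])
            show "s3 ''i'' 0 = Suc q" "edge_set s3 = {(a, b). b < a \<and> a < Suc q}"
              using I by (simp_all add: s3 update_def edge_set_def)
          next
            fix s4 assume "unchanged (writes add_edges) s3 s4"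
              "edge_set s4 = {(a, b). b < a \<and> a < Suc (Suc q)}"
            then show "triple (Set ''i'' (Inc (Var ''i''))) (?I (Suc q)) 6 s4"
              using I same
              by (intro wp_straight) (auto simp: unchanged_def wr s3 update_def edge_set_def less_Suc_eq)
          qed (use q in simp)
        qed simp
        with I r(2)[OF q] show "aval (Const 0) s2 < aval (Var ''x'') s2 \<and> triple ?c (?I (Suc q)) (27 * r + 52) s2"
          by simp
      qed (use r(1) in simp_all)
    next
      fix s2 assume un: "unchanged (writes (While (Const 0) (Var ''x'') ?c)) s1 s2" and I: "?I r s2"
      show "triple (add_edges ;; ?d) solution ((27 * Suc r + 8) + 10) s2"
      proof (rule wp_Seq[OF add_edges_correct[where v = "Suc r"] _ order_refl])
        show "s2 ''i'' 0 = Suc r" "edge_set s2 = {(a, b). b < a \<and> a < Suc r}" using I by simp_all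
      next
        fix s3 assume un3: "unchanged (writes add_edges) s2 s3"
          and e: "edge_set s3 = {(a, b). b < a \<and> a < Suc (Suc r)}"
        let ?s = "final ?d s3"
        have snk: "?s ''snk'' 0 = 0"
          using un un3 zero(3) by (simp add: unchanged_def wr s1 update_def)
        have label: "?s ''label'' (Suc j) = ?X ((?P ^^ j) target)" if "j < r" for j
          using un3 I that by (simp add: unchanged_def wr update_def)
        have nodes: "?s ''nodes'' 0 = r + 2" "?s ''src'' 0 = r + 1"
          using un3 I by (simp_all add: unchanged_def wr update_def)
        have edges: "edge_set ?s = {(a, b). b < a \<and> a < r + 2}"
          using e by (simp add: edge_set_def update_def)
        have "minimum_valid ts (set Cs) (the (result Cs ?s))"
          by (rule minimum_of_pointers[OF assms(1,2) pos r, where lab = "?s ''label''"])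
            (use label nodes edges snk in \<open>simp_all del: final.simps add: result_def edge_set_def\<close>)
        then have "solution ?s" using nodes by (simp del: final.simps add: solution_def result_def)
        then show "triple ?d solution 10 s3" by (rule wp_straight[rotated]) simp_all
      qed
    qed simp
  qed
qed (simp add: algebra_simps)

section \<open>The whole program\<close>

lemma program_correct:
  assumes "1 \<le> length Cs" "1 \<le> T"
  shows "triple program solution (1000 * ((n + 1) ^ (2 * length ts) * length Cs * T)) (initial ts n (length Cs))"
  unfolding program_def
proof -
  let ?B = "(n + 1) ^ (2 * length ts) * length Cs * T"
  let ?s = "initial ts n (length Cs)"
  let ?R = "\<lambda>s'. sound_state s' \<and> relaxed ranks (s' ''val'') \<and> s' ''tg'' 0 = target"
  have "1 * 1 \<le> length Cs * T" using assms by (intro mult_le_mono)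
  then have "codes * codes \<le> ?B" by (simp add: mult_2 power_add mult.assoc)
  moreover have "1 \<le> codes * codes" by simp
  ultimately have B: "codes * codes \<le> ?B" "1 \<le> ?B" by linarith+
  have "input ?s" by (simp add: input_def initial_def)
  have zero: "?s x = (\<lambda>_. 0)" if "x \<notin> {''m'', ''n'', ''k'', ''len''}" for x
    using that by (auto simp: initial_def)
  let ?c = "Cond (Const 0) (Var ''n'') search (Set ''val'' (Const 1))"
  have wr: "writes ?c \<inter> {''edges'', ''nodes'', ''snk''} = {}"
    by (auto simp: search_def weights_def relax_def improve_def odometer_def odometer_digit_def)
  have first: "triple ?c ?R (510 * ?B) ?s"
  proof (rule wp_Cond[where b = "500 * ?B"])
    assume "aval (Const 0) ?s < aval (Var ''n'') ?s"
    then have "1 \<le> n" using \<open>input ?s\<close> by (simp add: input_def)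
    from search_correct[OF \<open>input ?s\<close> this assms zero] show "triple search ?R (500 * ?B) ?s" .
  next
    assume "\<not> aval (Const 0) ?s < aval (Var ''n'') ?s"
    then have n: "n = 0" using \<open>input ?s\<close> by (simp add: input_def)
    \<comment> \<open>For \<open>n = 0\<close> there is a single code and every pair is a loop. The
      stored value 1 equals \<open>codes\<close>, and the unwritten \<open>tg\<close> is already the
      target.\<close>
    have "target = 0" using target_less n by simp
    moreover have "relaxed ranks V" for V
    proof -
      have "code a = 0 \<and> code b = 0" if "box ts a b" for a b
        using code_less[of a] code_less[of b] box_le_n[OF that] n by simp
      then show ?thesis by (auto simp: relaxed_def)
    qed
    ultimately have "?R (update ?s ''val'' 0 1)"
      using sound_init zero n by (simp add: update_def)
    moreover have "3 \<le> 500 * ?B" using B(2) by linarith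
    ultimately show "triple (Set ''val'' (Const 1)) ?R (500 * ?B) ?s"
      by (intro wp_straight) simp_all
  next
    show "1 + cost (Const 0) + cost (Var ''n'') + 500 * ?B \<le> 510 * ?B" using B(2) unfolding cost.simps by linarith
  qed
  show "triple (?c ;; trace_back) solution (1000 * ?B) ?s"
  proof (rule wp_Seq[OF first])
    fix s' assume un: "unchanged (writes ?c) ?s s'" and R: "?R s'"
    have "s' x = ?s x" if "x \<in> {''edges'', ''nodes'', ''snk''}" for x
      using un wr that unfolding unchanged_def by blast
    then have "s' ''edges'' 0 = 0" "s' ''nodes'' 0 = 0" "s' ''snk'' 0 = 0" using zero by simp_all
    then show "triple trace_back solution (200 * (codes * codes)) s'"
      using R by (intro trace_back_correct) auto
  next
    show "510 * ?B + 200 * (codes * codes) \<le> 1000 * ?B"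
      using mult_le_mono2[OF B(1), of 200] by linarith
  qed
qed

end

text \<open>Program and constant are chosen before the input, so they are uniform.
  \<open>1 \<le> k\<close> and \<open>1 \<le> T m n\<close> keep the bound from being 0, which no
  execution could meet.\<close>

theorem theorem3:
  "\<exists>(P :: com) (B :: nat).
     \<forall>(ts :: 'a list list) (Cs :: 'a criterion list) (ck :: nat \<Rightarrow> 'a segment set \<Rightarrow> nat)
      (T :: nat \<Rightarrow> nat \<Rightarrow> nat) (m :: nat) (n :: nat) (k :: nat).
       length ts = m \<and> (\<forall>\<tau> \<in> set ts. length \<tau> \<le> n) \<and> length Cs = k \<and> 1 \<le> k \<and>
       check_time_bound ts k ck m n (T m n) \<and> 1 \<le> T m n \<longrightarrow>
       (\<exists>t s. exec ts Cs ck P (initial ts n k) t s \<and>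
          t \<le> B * ((n + 1) ^ (2 * m) * k * T m n) \<and>
          (case result Cs s of
             None \<Rightarrow> \<nexists>F. flow_diagram (set Cs) F \<and> valid_for ts F
           | Some F \<Rightarrow> minimum_valid ts (set Cs) F))"
proof (rule exI[of _ program], rule exI[of _ 1000], intro allI impI)
  fix ts :: "'a list list" and Cs :: "'a criterion list" and ck :: "nat \<Rightarrow> 'a segment set \<Rightarrow> nat"
    and T :: "nat \<Rightarrow> nat \<Rightarrow> nat" and m n k :: nat
  assume A: "length ts = m \<and> (\<forall>\<tau> \<in> set ts. length \<tau> \<le> n) \<and> length Cs = k \<and> 1 \<le> k \<and>
       check_time_bound ts k ck m n (T m n) \<and> 1 \<le> T m n"
  interpret instance_with_checks ts Cs n ck "T m n"
    using A by unfold_locales auto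
  from program_correct A show "\<exists>t s. exec ts Cs ck program (initial ts n k) t s \<and>
          t \<le> 1000 * ((n + 1) ^ (2 * m) * k * T m n) \<and>
          (case result Cs s of
             None \<Rightarrow> \<nexists>F. flow_diagram (set Cs) F \<and> valid_for ts F
           | Some F \<Rightarrow> minimum_valid ts (set Cs) F)"
    by (auto simp: wp_def solution_def)
qed

end
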